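(* Let $(W,I)$ be of type $E_6$, and let $J_1,J_2$ be proper connected subsets of $I=\{1,\dots,6\}$. (1) If $2\notin J_1$ and $2\notin J_2$, then $J_1\star_I J_2=\emptyset$. (2) If $2\in J_1$ and $2\notin J_2$, then $$J_1\star_I J_2=\begin{cases}\{4,6\}, & \text{if } J_1=I-\{1\},\ J_2=I-\{2\};\\ \{1,4\}, & \text{if } J_1=I-\{6\},\ J_2=I-\{2\};\\ \emptyset, & \text{otherwise.}\end{cases}$$ (3) If $2\in J_1\cap J_2$, then $$J_1\star_I J_2=\begin{cases}\{2,4,5\}, & \text{if } J_1=J_2=I-\{1\};\\ \{2,3,4\}, & \text{if } J_1=J_2=I-\{6\};\\ \{3,4,5\}, & \text{if } \{J_1,J_2\}=\{I-\{1\},\,I-\{6\}\};\\ \{4\}, & \text{if } \{J_1,J_2\}=\{I-\{1\},\,I-\{1,6\}\};\\ \{4\}, & \text{if } \{J_1,J_2\}=\{I-\{6\},\,I-\{1,6\}\};\\ \emptyset, & \text{otherwise.}\end{cases}$$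
   Context: $(W,I)$ is a finite Coxeter group with simple reflections $s_i$ ($i\in I$). The monoid operation $\ast$ on $W$ is determined by $T'_xT'_y=T'_{x\ast y}$ in the $0$-Hecke algebra, where $T'_{s_i}$ satisfy $T'^2_{s_i}=T'_{s_i}$ and the braid relations, and $T'_w=T'_{s_{i_1}}\cdots T'_{s_{i_k}}$ for any reduced expression $w=s_{i_1}\cdots s_{i_k}$; equivalently $s_i\ast w$ is the Bruhat-larger of $w$ and $s_iw$. For $J\subset I$, $w_0^J$ is the longest element of $W_J=\langle s_j: j\in J\rangle$. For $J_1,J_2\subset I$, $J_1\star_I J_2$ is the unique subset $K\subset I$ with $(w_0^{J_1}w_0^I)\ast(w_0^{J_2}w_0^I)=w_0^{K}w_0^I$ (such a $K$ always exists); $\star_I$ is commutative. Connected means connected in the Coxeter graph. Type $E_6$: Bourbaki labeling, simple edges $1-3-4-5-6$ and $2-4$. *)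

theory Defs
  imports "HOL-Algebra.Algebra" "HOL-Library.Poly_Mapping"
begin

section \<open>Words and Coxeter systems\<close>

definition word_prod :: "('a, 'b) monoid_scheme \<Rightarrow> ('i \<Rightarrow> 'a) \<Rightarrow> 'i list \<Rightarrow> 'a" where
  "word_prod M f u = foldr (\<lambda>i x. f i \<otimes>\<^bsub>M\<^esub> x) u \<one>\<^bsub>M\<^esub>"

text \<open>An entry \<open>0\<close> of a Coxeter matrix stands for \<open>\<infinity>\<close>: the relations attached to it below are trivial.\<close>

definition coxeter_matrix :: "'i set \<Rightarrow> ('i \<Rightarrow> 'i \<Rightarrow> nat) \<Rightarrow> bool" where
  "coxeter_matrix I m \<longleftrightarrow>
     (\<forall>i\<in>I. m i i = 1) \<and>
     (\<forall>i\<in>I. \<forall>j\<in>I. m i j = m j i) \<and>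
     (\<forall>i\<in>I. \<forall>j\<in>I. i \<noteq> j \<longrightarrow> m i j \<noteq> 1)"

inductive cox_step :: "'i set \<Rightarrow> ('i \<Rightarrow> 'i \<Rightarrow> nat) \<Rightarrow> 'i list \<Rightarrow> 'i list \<Rightarrow> bool"
  for I :: "'i set" and m :: "'i \<Rightarrow> 'i \<Rightarrow> nat" where
  "\<lbrakk>u \<in> lists I; v \<in> lists I; i \<in> I; j \<in> I\<rbrakk>
     \<Longrightarrow> cox_step I m (u @ concat (replicate (m i j) [i, j]) @ v) (u @ v)"

text \<open>
  The last two conjuncts say that \<open>G\<close> is the group presented by the generators \<open>s i\<close> and the
  relations \<open>(s i \<otimes> s j) ^ m i j = \<one>\<close>. Since \<open>m i i = 1\<close> makes every \<open>s i\<close> an involution, words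
  without inverse letters suffice.
\<close>

definition coxeter_system ::
  "('a, 'b) monoid_scheme \<Rightarrow> 'i set \<Rightarrow> ('i \<Rightarrow> 'a) \<Rightarrow> ('i \<Rightarrow> 'i \<Rightarrow> nat) \<Rightarrow> bool" where
  "coxeter_system G I s m \<longleftrightarrow>
     group G \<and> coxeter_matrix I m \<and> s \<in> I \<rightarrow> carrier G \<and>
     generate G (s ` I) = carrier G \<and>
     (\<forall>u\<in>lists I. \<forall>v\<in>lists I.
        word_prod G s u = word_prod G s v \<longleftrightarrow> equivclp (cox_step I m) u v)"

definition cox_length :: "('a, 'b) monoid_scheme \<Rightarrow> 'i set \<Rightarrow> ('i \<Rightarrow> 'a) \<Rightarrow> 'a \<Rightarrow> nat" where
  "cox_length G I s w = (LEAST n. \<exists>u\<in>lists I. length u = n \<and> word_prod G s u = w)"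

definition reduced_expr ::
  "('a, 'b) monoid_scheme \<Rightarrow> 'i set \<Rightarrow> ('i \<Rightarrow> 'a) \<Rightarrow> 'a \<Rightarrow> 'i list \<Rightarrow> bool" where
  "reduced_expr G I s w u \<longleftrightarrow>
     u \<in> lists I \<and> word_prod G s u = w \<and> length u = cox_length G I s w"

definition longest_elt ::
  "('a, 'b) monoid_scheme \<Rightarrow> 'i set \<Rightarrow> ('i \<Rightarrow> 'a) \<Rightarrow> 'i set \<Rightarrow> 'a" where
  "longest_elt G I s J =
     (THE w. is_arg_max (cox_length G I s) (\<lambda>w. w \<in> generate G (s ` J)) w)"

definition cox_connected :: "('i \<Rightarrow> 'i \<Rightarrow> nat) \<Rightarrow> 'i set \<Rightarrow> bool" where
  "cox_connected m J \<longleftrightarrow>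
     (\<forall>i\<in>J. \<forall>j\<in>J. (i, j) \<in> {(a, b). a \<in> J \<and> b \<in> J \<and> a \<noteq> b \<and> m a b \<noteq> 2}\<^sup>*)"


section \<open>The 0-Hecke algebra\<close>

text \<open>
  Free monoid, written additively so that \<^typ>\<open>'k \<Rightarrow>\<^sub>0 int\<close> over it carries the convolution product.
\<close>

datatype 'i fmon = FMon "'i list"

instantiation fmon :: (type) monoid_add
begin

definition zero_fmon :: "'a fmon" where
  "zero_fmon = FMon []"

fun plus_fmon :: "'a fmon \<Rightarrow> 'a fmon \<Rightarrow> 'a fmon" where
  "plus_fmon (FMon u) (FMon v) = FMon (u @ v)"

instance
proof
  fix a b c :: "'a fmon"
  show "a + b + c = a + (b + c)"
    by (cases a; cases b; cases c) simp
  show "0 + a = a" "a + 0 = a"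
    by (cases a; simp add: zero_fmon_def)+
qed

end

definition free_algebra :: "'i set \<Rightarrow> ('i fmon \<Rightarrow>\<^sub>0 int) ring" where
  "free_algebra I =
     \<lparr>carrier = {p. Poly_Mapping.keys p \<subseteq> FMon ` lists I},
      monoid.mult = (*), one = 1, ring.zero = 0, ring.add = (+)\<rparr>"

definition free_gen :: "'i \<Rightarrow> 'i fmon \<Rightarrow>\<^sub>0 int" where
  "free_gen i = Poly_Mapping.single (FMon [i]) 1"

fun alt_word :: "'i \<Rightarrow> 'i \<Rightarrow> nat \<Rightarrow> 'i list" where
  "alt_word i j 0 = []"
| "alt_word i j (Suc n) = i # alt_word j i n"

definition hecke0_relations :: "'i set \<Rightarrow> ('i \<Rightarrow> 'i \<Rightarrow> nat) \<Rightarrow> ('i fmon \<Rightarrow>\<^sub>0 int) set" where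
  "hecke0_relations I m =
     {free_gen i * free_gen i - free_gen i | i. i \<in> I} \<union>
     {word_prod (free_algebra I) free_gen (alt_word i j (m i j)) -
      word_prod (free_algebra I) free_gen (alt_word j i (m i j)) | i j. i \<in> I \<and> j \<in> I \<and> i \<noteq> j}"

definition hecke0_ideal :: "'i set \<Rightarrow> ('i \<Rightarrow> 'i \<Rightarrow> nat) \<Rightarrow> ('i fmon \<Rightarrow>\<^sub>0 int) set" where
  "hecke0_ideal I m = Idl\<^bsub>free_algebra I\<^esub> (hecke0_relations I m)"

definition hecke0 :: "'i set \<Rightarrow> ('i \<Rightarrow> 'i \<Rightarrow> nat) \<Rightarrow> ('i fmon \<Rightarrow>\<^sub>0 int) set ring" where
  "hecke0 I m = free_algebra I Quot hecke0_ideal I m"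

definition hecke0_gen :: "'i set \<Rightarrow> ('i \<Rightarrow> 'i \<Rightarrow> nat) \<Rightarrow> 'i \<Rightarrow> ('i fmon \<Rightarrow>\<^sub>0 int) set" where
  "hecke0_gen I m i = hecke0_ideal I m +>\<^bsub>free_algebra I\<^esub> free_gen i"

text \<open>
  The element \<open>T'\<^sub>w\<close>. It does not depend on the reduced expression chosen, because any two reduced
  expressions of \<open>w\<close> are related by braid relations (Matsumoto).
\<close>

definition hecke0_basis ::
  "('a, 'b) monoid_scheme \<Rightarrow> 'i set \<Rightarrow> ('i \<Rightarrow> 'a) \<Rightarrow> ('i \<Rightarrow> 'i \<Rightarrow> nat) \<Rightarrow> 'a
     \<Rightarrow> ('i fmon \<Rightarrow>\<^sub>0 int) set" where
  "hecke0_basis G I s m w =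
     word_prod (hecke0 I m) (hecke0_gen I m) (SOME u. reduced_expr G I s w u)"

definition cox_ast ::
  "('a, 'b) monoid_scheme \<Rightarrow> 'i set \<Rightarrow> ('i \<Rightarrow> 'a) \<Rightarrow> ('i \<Rightarrow> 'i \<Rightarrow> nat) \<Rightarrow> 'a \<Rightarrow> 'a \<Rightarrow> 'a" where
  "cox_ast G I s m x y =
     (THE z. z \<in> carrier G \<and>
        hecke0_basis G I s m x \<otimes>\<^bsub>hecke0 I m\<^esub> hecke0_basis G I s m y = hecke0_basis G I s m z)"


section \<open>The operation on subsets\<close>

definition cox_star ::
  "('a, 'b) monoid_scheme \<Rightarrow> 'i set \<Rightarrow> ('i \<Rightarrow> 'a) \<Rightarrow> ('i \<Rightarrow> 'i \<Rightarrow> nat)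
     \<Rightarrow> 'i set \<Rightarrow> 'i set \<Rightarrow> 'i set" where
  "cox_star G I s m J1 J2 =
     (THE K. K \<subseteq> I \<and>
        cox_ast G I s m
          (longest_elt G I s J1 \<otimes>\<^bsub>G\<^esub> longest_elt G I s I)
          (longest_elt G I s J2 \<otimes>\<^bsub>G\<^esub> longest_elt G I s I)
        = longest_elt G I s K \<otimes>\<^bsub>G\<^esub> longest_elt G I s I)"


section \<open>Type E6\<close>

definition E6_edges :: "nat set set" where
  "E6_edges = {{1, 3}, {3, 4}, {4, 5}, {5, 6}, {2, 4}}"

definition E6_matrix :: "nat \<Rightarrow> nat \<Rightarrow> nat" where
  "E6_matrix i j = (if i = j then 1 else if {i, j} \<in> E6_edges then 3 else 2)"

end

theory Submission
  imports Defs
begin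

text \<open>
  The computation of \<open>J1 \<star> J2\<close> is transported to the numbers game of Mozes, where it becomes
  arithmetic with six integers. Attach to \<open>w\<close> the integers \<open>ht w i\<close>, the height of the root
  \<open>w\<^sup>-\<^sup>1 \<alpha>\<^sub>i\<close>. Multiplying \<open>w\<close> by \<open>s i\<close> on the left negates the number at the node \<open>i\<close> and adds
  its old value to the neighbours of \<open>i\<close>; in a simply laced group this rule is all one needs to
  know about roots. The key fact is that multiplication by \<open>s i\<close> lengthens \<open>w\<close>
  exactly if the number at \<open>i\<close> is positive (\<open>ascent_iff\<close>, from \<open>numbers_ge_if_ascent\<close>). Hence the numbers determine \<open>w\<close> (\<open>ht_inj\<close>), and the
  larger of \<open>w\<close> and \<open>s\<^sub>i w\<close> can be found by looking at a sign.

  To connect this with the 0-Hecke algebra, two things are needed. The operators that replace \<open>w\<close> by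
  the larger of \<open>w\<close> and \<open>s\<^sub>i w\<close> satisfy the 0-Hecke relations, so the algebra acts on the free
  abelian group over \<open>W\<close>, and this action separates the elements \<open>T'\<^sub>w\<close>. Conversely, every product of
  generators equals some \<open>T'\<^sub>w\<close>, by Matsumoto's theorem (\<open>matsumoto\<close>). Together they give
  \<open>cox_ast_demazure_word\<close>: if \<open>u\<close> is a word whose operators take \<open>1\<close> to \<open>x\<close>, then they take \<open>y\<close> to
  \<open>x \<ast> y\<close>.

  The longest element \<open>w\<^sub>J\<close> of \<open>W\<^sub>J\<close> is the only element of \<open>W\<^sub>J\<close> with negative numbers at all nodes of
  \<open>J\<close> (\<open>parabolic_longest_unique\<close>). The numbers of \<open>w\<^sub>I\<close> are all \<open>-1\<close>, and therefore those of
  \<open>w\<^sub>J w\<^sub>I\<close> are the negatives of those of \<open>w\<^sub>J\<close>. So \<open>J1 \<star> J2 = K\<close> means that the operators along a word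
  for \<open>w\<^sub>J\<^sub>1 w\<^sub>I\<close> turn the numbers of \<open>w\<^sub>J\<^sub>2 w\<^sub>I\<close> into those of \<open>w\<^sub>K w\<^sub>I\<close>. The diagram has 25 proper connected
  subsets, the empty one included, and the 625 pairs are evaluated by rewriting.
\<close>

section \<open>Words and length in simply laced Coxeter groups\<close>

lemma word_prod_Nil [simp]: "word_prod M f [] = \<one>\<^bsub>M\<^esub>"
  and word_prod_Cons [simp]: "word_prod M f (i # u) = f i \<otimes>\<^bsub>M\<^esub> word_prod M f u"
  by (simp_all add: word_prod_def)

lemma (in monoid) word_prod_closed:
  "f \<in> I \<rightarrow> carrier G \<Longrightarrow> u \<in> lists I \<Longrightarrow> word_prod G f u \<in> carrier G"
  by (induction u) auto

lemma (in monoid) word_prod_append: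
  "f \<in> I \<rightarrow> carrier G \<Longrightarrow> u \<in> lists I \<Longrightarrow> v \<in> lists I \<Longrightarrow>
   word_prod G f (u @ v) = word_prod G f u \<otimes> word_prod G f v"
  by (induction u) (auto simp: m_assoc word_prod_closed Pi_iff)

locale simply_laced_coxeter =
  fixes G :: "('a, 'b) monoid_scheme" (structure)
    and I :: "'i set" and s :: "'i \<Rightarrow> 'a" and m :: "'i \<Rightarrow> 'i \<Rightarrow> nat"
  assumes cox: "coxeter_system G I s m"
    and laced: "\<And>i j. i \<in> I \<Longrightarrow> j \<in> I \<Longrightarrow> i \<noteq> j \<Longrightarrow> m i j = 2 \<or> m i j = 3"
begin

sublocale group G
  using cox by (simp add: coxeter_system_def)

abbreviation wprod :: "'i list \<Rightarrow> 'a" where "wprod \<equiv> word_prod G s"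

abbreviation len :: "'a \<Rightarrow> nat" where "len \<equiv> cox_length G I s"

lemma m_diag [simp]: "i \<in> I \<Longrightarrow> m i i = 1"
  and m_sym: "i \<in> I \<Longrightarrow> j \<in> I \<Longrightarrow> m i j = m j i"
  using cox by (auto simp: coxeter_system_def coxeter_matrix_def)

lemma s_Pi: "s \<in> I \<rightarrow> carrier G"
  using cox by (simp add: coxeter_system_def)

lemma s_closed [simp]: "i \<in> I \<Longrightarrow> s i \<in> carrier G"
  using s_Pi by auto

lemma wprod_closed [simp]: "u \<in> lists I \<Longrightarrow> wprod u \<in> carrier G"
  by (rule word_prod_closed[OF s_Pi])

lemma wprod_append: "u \<in> lists I \<Longrightarrow> v \<in> lists I \<Longrightarrow> wprod (u @ v) = wprod u \<otimes> wprod v"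
  by (rule word_prod_append[OF s_Pi])

lemma wprod_eq_iff: "u \<in> lists I \<Longrightarrow> v \<in> lists I \<Longrightarrow> wprod u = wprod v \<longleftrightarrow> equivclp (cox_step I m) u v"
  using cox by (simp add: coxeter_system_def)

lemma cox_step_lists: "cox_step I m u v \<Longrightarrow> u \<in> lists I \<and> v \<in> lists I"
  by (induction rule: cox_step.induct) (auto simp: lists_eq_set)

text \<open>
  The way in which the presentation is used: to define a function on the group it suffices to define
  it on words and to check that deleting a relator does not change the value.
\<close>

lemma cox_step_invariant:
  assumes "\<And>u v. cox_step I m u v \<Longrightarrow> F u = F v"
    and "u \<in> lists I" "v \<in> lists I" "wprod u = wprod v"
  shows "F u = F v"
proof -
  have "equivclp (cox_step I m) u v"
    using assms(2-4) wprod_eq_iff by blast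
  then show ?thesis
    by (induction rule: equivclp_induct) (use assms(1) in force)+
qed

lemma wprod_relation:
  assumes "i \<in> I" "j \<in> I"
  shows "wprod (concat (replicate (m i j) [i, j])) = \<one>"
proof -
  have "cox_step I m ([] @ concat (replicate (m i j) [i, j]) @ []) ([] @ [])"
    using assms by (intro cox_step.intros) auto
  then have *: "cox_step I m (concat (replicate (m i j) [i, j])) []"
    by simp
  then have "wprod (concat (replicate (m i j) [i, j])) = wprod []"
    using wprod_eq_iff cox_step_lists by blast
  then show ?thesis by simp
qed

lemma s_cancel [simp]:
  assumes "i \<in> I" "w \<in> carrier G"
  shows "s i \<otimes> (s i \<otimes> w) = w"
proof -
  have "s i \<otimes> s i = \<one>"
    using wprod_relation[of i i] assms by simp
  then show ?thesis
    using assms by (simp flip: m_assoc)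
qed

lemma s_commute:
  assumes "i \<in> I" "j \<in> I" "m i j = 2" "w \<in> carrier G"
  shows "s i \<otimes> (s j \<otimes> w) = s j \<otimes> (s i \<otimes> w)"
proof -
  have "s i \<otimes> (s j \<otimes> (s i \<otimes> s j)) = \<one>"
    using wprod_relation[of i j] assms by (simp add: numeral_eq_Suc)
  then have "s i \<otimes> (s j \<otimes> (s i \<otimes> s j)) \<otimes> (s j \<otimes> (s i \<otimes> w)) = s j \<otimes> (s i \<otimes> w)"
    using assms by simp
  then show ?thesis
    using assms by (simp add: m_assoc)
qed

lemma s_braid:
  assumes "i \<in> I" "j \<in> I" "m i j = 3" "w \<in> carrier G"
  shows "s i \<otimes> (s j \<otimes> (s i \<otimes> w)) = s j \<otimes> (s i \<otimes> (s j \<otimes> w))"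
proof -
  have "s i \<otimes> (s j \<otimes> (s i \<otimes> (s j \<otimes> (s i \<otimes> s j)))) = \<one>"
    using wprod_relation[of i j] assms by (simp add: numeral_eq_Suc)
  then have "s i \<otimes> (s j \<otimes> (s i \<otimes> (s j \<otimes> (s i \<otimes> s j)))) \<otimes> (s j \<otimes> (s i \<otimes> (s j \<otimes> w)))
      = s j \<otimes> (s i \<otimes> (s j \<otimes> w))"
    using assms by simp
  then show ?thesis
    using assms by (simp add: m_assoc)
qed

lemma inv_s: "i \<in> I \<Longrightarrow> inv (s i) = s i"
  using s_cancel[of i \<one>] by (metis inv_unique' one_closed r_one s_closed inv_equality)

lemma generate_eq_words:
  assumes "J \<subseteq> I"
  shows "generate G (s ` J) = wprod ` lists J"
proof
  have J: "u \<in> lists I" if "u \<in> lists J" for u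
    using that assms lists_mono by blast
  show "generate G (s ` J) \<subseteq> wprod ` lists J"
  proof
    fix w assume "w \<in> generate G (s ` J)"
    then show "w \<in> wprod ` lists J"
    proof (induction rule: generate.induct)
      case one
      show ?case by (rule image_eqI[of _ _ "[]"]) auto
    next
      case (incl h)
      then obtain j where "j \<in> J" "h = s j" by auto
      then show ?case
        using assms by (intro image_eqI[of _ _ "[j]"]) auto
    next
      case (inv h)
      then obtain j where "j \<in> J" "h = s j" by auto
      then show ?case
        using assms inv_s by (intro image_eqI[of _ _ "[j]"]) auto
    next
      case (eng g h)
      then obtain u v where "u \<in> lists J" "g = wprod u" "v \<in> lists J" "h = wprod v" by auto
      then show ?case
        using J by (intro image_eqI[of _ _ "u @ v"]) (auto simp: wprod_append)
    qed
  qed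
  have "wprod u \<in> generate G (s ` J)" if "u \<in> lists J" for u
    using that by (induction u) (auto intro: generate.intros)
  then show "wprod ` lists J \<subseteq> generate G (s ` J)" by auto
qed

lemma carrier_eq_words: "carrier G = wprod ` lists I"
  using cox generate_eq_words[of I] by (simp add: coxeter_system_def)

lemma ex_reduced_expr:
  assumes "w \<in> carrier G"
  obtains u where "reduced_expr G I s w u"
proof -
  obtain v where v: "v \<in> lists I" "wprod v = w"
    using assms carrier_eq_words by auto
  have "\<exists>u\<in>lists I. length u = len w \<and> wprod u = w"
    unfolding cox_length_def by (rule LeastI[of _ "length v"]) (use v in auto)
  then show ?thesis
    using that by (auto simp: reduced_expr_def)
qed

lemma len_le: "u \<in> lists I \<Longrightarrow> len (wprod u) \<le> length u"
  unfolding cox_length_def by (rule Least_le) auto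

lemma len_s_le:
  assumes "i \<in> I" "w \<in> carrier G"
  shows "len (s i \<otimes> w) \<le> len w + 1"
proof -
  obtain u where "reduced_expr G I s w u"
    using assms ex_reduced_expr by blast
  then show ?thesis
    using len_le[of "i # u"] assms by (auto simp: reduced_expr_def)
qed

lemma len_s_ge: "i \<in> I \<Longrightarrow> w \<in> carrier G \<Longrightarrow> len w \<le> len (s i \<otimes> w) + 1"
  using len_s_le[of i "s i \<otimes> w"] by simp

text \<open>
  All relators have even length, so the parity of the length is a homomorphism; this excludes
  equal lengths of \<open>w\<close> and \<open>s i \<otimes> w\<close>.
\<close>

lemma len_parity:
  assumes "u \<in> lists I"
  shows "even (len (wprod u)) \<longleftrightarrow> even (length u)"
proof -
  obtain v where v: "reduced_expr G I s (wprod u) v"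
    using assms ex_reduced_expr wprod_closed by metis
  have "even (length v) = even (length u)"
  proof (rule cox_step_invariant[where F = "\<lambda>u. even (length u)"])
    show "even (length u) = even (length v)" if "cox_step I m u v" for u v
      using that by cases (auto simp: length_concat sum_list_replicate)
  qed (use v assms in \<open>auto simp: reduced_expr_def\<close>)
  then show ?thesis
    using v by (simp add: reduced_expr_def)
qed

lemma len_s_neq:
  assumes "i \<in> I" "w \<in> carrier G"
  shows "len (s i \<otimes> w) \<noteq> len w"
proof -
  obtain u where "u \<in> lists I" "wprod u = w"
    using assms carrier_eq_words by auto
  then show ?thesis
    using len_parity[of u] len_parity[of "i # u"] assms by fastforce
qed

lemma len_s_cases:
  assumes "i \<in> I" "w \<in> carrier G"
  shows "len (s i \<otimes> w) = len w + 1 \<or> len w = len (s i \<otimes> w) + 1"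
  using len_s_le[OF assms] len_s_ge[OF assms] len_s_neq[OF assms] by linarith

lemma len_one [simp]: "len \<one> = 0"
  using len_le[of "[]"] by simp

lemma reduced_Cons:
  assumes "reduced_expr G I s w (i # u)"
  shows "i \<in> I" "w = s i \<otimes> wprod u" "s i \<otimes> w = wprod u" "reduced_expr G I s (s i \<otimes> w) u"
    "len w = len (s i \<otimes> w) + 1"
proof -
  show i: "i \<in> I" and w: "w = s i \<otimes> wprod u"
    using assms by (auto simp: reduced_expr_def)
  have u: "u \<in> lists I" "len w = length u + 1"
    using assms by (auto simp: reduced_expr_def)
  then show sw: "s i \<otimes> w = wprod u"
    using i w by simp
  have "len (wprod u) = length u"
    using len_le[OF u(1)] len_s_le[of i "wprod u"] u i w by simp
  then show "reduced_expr G I s (s i \<otimes> w) u" "len w = len (s i \<otimes> w) + 1"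
    using u sw by (auto simp: reduced_expr_def)
qed

lemma Cons_reduced:
  assumes "i \<in> I" "w \<in> carrier G" "len (s i \<otimes> w) = len w + 1" "reduced_expr G I s w u"
  shows "reduced_expr G I s (s i \<otimes> w) (i # u)"
  using assms by (auto simp: reduced_expr_def)

lemma ex_descent:
  assumes "w \<in> carrier G" "w \<noteq> \<one>"
  obtains i where "i \<in> I" "len w = len (s i \<otimes> w) + 1"
proof -
  obtain u where u: "reduced_expr G I s w u"
    using assms ex_reduced_expr by blast
  then obtain i v where "u = i # v"
    using assms by (cases u) (auto simp: reduced_expr_def)
  then show ?thesis
    using reduced_Cons[of w i v] u that by blast
qed

section \<open>The numbers game\<close>

text \<open>
  With \<open>c i = \<langle>\<lambda>, \<alpha>\<^sub>i\<rangle>\<close> for a weight \<open>\<lambda>\<close>, firing the node \<open>i\<close> gives the coordinates of \<open>s\<^sub>i \<lambda>\<close>. The rule has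
  no sum in it, since \<open>s\<^sub>i\<close> subtracts a multiple of the single root \<open>\<alpha>\<^sub>i\<close>.
\<close>

definition fire :: "'i \<Rightarrow> ('i \<Rightarrow> int) \<Rightarrow> 'i \<Rightarrow> int" where
  "fire i c = (\<lambda>j. if j = i then - c i else if m i j = 3 then c j + c i else c j)"

definition play :: "'i list \<Rightarrow> ('i \<Rightarrow> int) \<Rightarrow> 'i \<Rightarrow> int" where
  "play u c = foldr fire u c"

lemma play_simps [simp]: "play [] c = c" "play (i # u) c = fire i (play u c)"
  "play (u @ v) c = play u (play v c)"
  by (simp_all add: play_def)

lemma fire_fire: "i \<in> I \<Longrightarrow> fire i (fire i c) = c"
  by (auto simp: fire_def)

lemma play_relation:
  assumes "i \<in> I" "j \<in> I"
  shows "play (concat (replicate (m i j) [i, j])) c = c"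
proof (cases "i = j")
  case True
  then show ?thesis using assms by (simp add: fire_fire)
next
  case False
  then consider "m i j = 2" "m j i = 2" | "m i j = 3" "m j i = 3"
    using laced m_sym assms by metis
  then show ?thesis
    by cases (use False in \<open>auto simp: numeral_eq_Suc fire_def fun_eq_iff\<close>)
qed

text \<open>
  The coordinates of \<open>w \<lambda>\<close>, where \<open>c\<close> are those of \<open>\<lambda>\<close>. By \<open>play_relation\<close> the choice of the word
  does not matter.
\<close>

definition numbers :: "('i \<Rightarrow> int) \<Rightarrow> 'a \<Rightarrow> 'i \<Rightarrow> int" where
  "numbers c w = play (SOME u. u \<in> lists I \<and> wprod u = w) c"

lemma numbers_wprod:
  assumes "u \<in> lists I"
  shows "numbers c (wprod u) = play u c"
proof -
  define v where "v = (SOME v. v \<in> lists I \<and> wprod v = wprod u)"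
  have v: "v \<in> lists I \<and> wprod v = wprod u"
    unfolding v_def by (rule someI[of _ u]) (use assms in simp)
  have "play v c = play u c"
  proof (rule cox_step_invariant[where F = "\<lambda>u. play u c"])
    show "play u c = play v c" if "cox_step I m u v" for u v
      using that by cases (simp add: play_relation)
  qed (use v assms in auto)
  then show ?thesis
    by (simp add: numbers_def v_def)
qed

lemma numbers_one [simp]: "numbers c \<one> = c"
  using numbers_wprod[of "[]"] by simp

lemma numbers_s [simp]:
  assumes "i \<in> I" "w \<in> carrier G"
  shows "numbers c (s i \<otimes> w) = fire i (numbers c w)"
proof -
  obtain u where "u \<in> lists I" "wprod u = w"
    using assms carrier_eq_words by auto
  then show ?thesis
    using numbers_wprod[of "i # u"] numbers_wprod[of u] assms by auto
qed

lemma numbers_mult: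
  assumes "u \<in> lists I" "w \<in> carrier G"
  shows "numbers c (wprod u \<otimes> w) = play u (numbers c w)"
  using assms by (induction u) (auto simp: m_assoc)

text \<open>
  The geometric fact that \<open>w\<^sup>-\<^sup>1 \<alpha>\<^sub>i\<close> is a positive root if \<open>s\<^sub>i w\<close> is longer than \<open>w\<close>, paired with a
  dominant weight. If \<open>j\<close> is a left descent of \<open>w\<close>, split off the part of \<open>w\<close> in the dihedral group
  of \<open>i\<close> and \<open>j\<close>: then \<open>w\<close> is \<open>s\<^sub>j v\<close> or \<open>s\<^sub>j s\<^sub>i x\<close>, and the number of \<open>w\<close> at \<open>i\<close> is one of the numbers of
  the shorter element or a sum of two of them, all of which are covered by the induction hypothesis. The bound
  \<open>t\<close> serves two purposes: \<open>t = 1\<close> for the regular weight, which detects descents, and \<open>t = 0\<close> for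
  the singular weights that have a parabolic subgroup as stabiliser.
\<close>

theorem numbers_ge_if_ascent:
  assumes "0 \<le> t" "\<And>i. i \<in> I \<Longrightarrow> t \<le> c i"
    and "w \<in> carrier G" "i \<in> I" "len w < len (s i \<otimes> w)"
  shows "t \<le> numbers c w i"
  using assms(3-)
proof (induction "len w" arbitrary: w i rule: less_induct)
  case less
  note IH = less.hyps
  show ?case
  proof (cases "w = \<one>")
    case True
    then show ?thesis using assms(2) less.prems by simp
  next
    case False
    then obtain j where j: "j \<in> I" "len w = len (s j \<otimes> w) + 1"
      using less.prems ex_descent by blast
    then have neq: "i \<noteq> j"
      using less.prems by auto
    define v where "v = s j \<otimes> w"
    have v: "v \<in> carrier G" "w = s j \<otimes> v" "len w = len v + 1"
      using j less.prems by (auto simp: v_def)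
    consider "m i j = 2" "m j i = 2" | "m i j = 3" "m j i = 3"
      using laced m_sym neq j less.prems by metis
    then show ?thesis
    proof cases
      case 1
      have "len v < len (s i \<otimes> v)"
      proof (rule ccontr)
        assume "\<not> ?thesis"
        then have "len v = len (s i \<otimes> v) + 1"
          using len_s_cases[of i v] less.prems v by auto
        moreover have "s i \<otimes> w = s j \<otimes> (s i \<otimes> v)"
          using 1 v j less.prems s_commute by simp
        ultimately show False
          using less.prems len_s_le[of j "s i \<otimes> v"] v j by simp
      qed
      then have "t \<le> numbers c v i"
        using IH v less.prems by simp
      then show ?thesis
        using v j 1 neq by (simp add: fire_def)
    next
      case 2
      have vj: "t \<le> numbers c v j"
        using IH[of v j] v j by simp
      show ?thesis
      proof (cases "len v < len (s i \<otimes> v)")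
        case True
        then have "t \<le> numbers c v i"
          using IH v less.prems by simp
        then show ?thesis
          using v vj 2 neq j assms(1) by (simp add: fire_def)
      next
        case False
        define x where "x = s i \<otimes> v"
        have x: "x \<in> carrier G" "v = s i \<otimes> x" "len v = len x + 1"
          using False len_s_cases[of i v] less.prems v by (auto simp: x_def)
        have "len x < len (s j \<otimes> x)"
        proof (rule ccontr)
          assume "\<not> ?thesis"
          then have y: "len x = len (s j \<otimes> x) + 1"
            using len_s_cases[of j x] j x by auto
          let ?y = "s j \<otimes> x"
          have "s i \<otimes> w = s j \<otimes> (s i \<otimes> ?y)"
            using v x 2 j less.prems s_braid[of i j x] by simp
          then have "len (s i \<otimes> w) \<le> len ?y + 2"
            using len_s_le[of j "s i \<otimes> ?y"] len_s_le[of i ?y] x j less.prems by simp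
          then show False
            using y x v less.prems by simp
        qed
        then have "t \<le> numbers c x j"
          using IH x v j by simp
        then show ?thesis
          using x v j less.prems 2 neq by (simp add: fire_def)
      qed
    qed
  qed
qed

text \<open>
  The start with all numbers \<open>1\<close> is the weight \<open>\<rho>\<close>, which pairs with a root to the height of that
  root. It is regular, so the signs of these numbers show all descents.
\<close>

abbreviation ht :: "'a \<Rightarrow> 'i \<Rightarrow> int" where "ht \<equiv> numbers (\<lambda>_. 1)"

lemma ascent_iff:
  assumes "w \<in> carrier G" "i \<in> I"
  shows "len w < len (s i \<otimes> w) \<longleftrightarrow> 0 < ht w i"
proof
  show "0 < ht w i" if "len w < len (s i \<otimes> w)"
    using numbers_ge_if_ascent[of 1 "\<lambda>_. 1" w i] assms that by simp
  show "len w < len (s i \<otimes> w)" if "0 < ht w i"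
  proof (rule ccontr)
    assume "\<not> ?thesis"
    then have "len (s i \<otimes> w) < len (s i \<otimes> (s i \<otimes> w))"
      using len_s_cases[OF assms(2,1)] assms by auto
    then show False
      using numbers_ge_if_ascent[of 1 "\<lambda>_. 1" "s i \<otimes> w" i] assms that by (simp add: fire_def)
  qed
qed

lemma ht_nonzero: "w \<in> carrier G \<Longrightarrow> i \<in> I \<Longrightarrow> ht w i \<noteq> 0"
  using ascent_iff[of w i] ascent_iff[of "s i \<otimes> w" i] len_s_cases[of i w]
  by (auto simp: fire_def)

lemma descent_iff:
  assumes "w \<in> carrier G" "i \<in> I"
  shows "len w = len (s i \<otimes> w) + 1 \<longleftrightarrow> ht w i < 0"
  using ascent_iff[OF assms] ht_nonzero[OF assms] len_s_cases[OF assms(2,1)] by linarith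

lemma fire_cong: "(\<And>j. j \<in> J \<Longrightarrow> c j = d j) \<Longrightarrow> i \<in> J \<Longrightarrow> j \<in> J \<Longrightarrow> fire i c j = fire i d j"
  by (auto simp: fire_def)

lemma eq_one_if_no_descent:
  assumes "w \<in> carrier G" "\<And>i. i \<in> I \<Longrightarrow> 0 \<le> ht w i"
  shows "w = \<one>"
proof (rule ccontr)
  assume "w \<noteq> \<one>"
  then obtain i where i: "i \<in> I" "len w = len (s i \<otimes> w) + 1"
    using assms ex_descent by blast
  then show False
    using assms(2)[of i] descent_iff[OF assms(1) i(1)] by linarith
qed

text \<open>
  Elements with equal numbers have equal descents, and multiplying both by the same descent keeps
  their numbers equal. After \<open>len w\<close> steps \<open>w\<close> has become \<open>\<one>\<close>, and so has \<open>x\<close>, as it has no descent left.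
\<close>

lemma ht_inj:
  assumes "w \<in> carrier G" "x \<in> carrier G" "\<And>i. i \<in> I \<Longrightarrow> ht w i = ht x i"
  shows "w = x"
  using assms
proof (induction "len w" arbitrary: w x rule: less_induct)
  case less
  show ?case
  proof (cases "w = \<one>")
    case True
    then show ?thesis
      using less.prems eq_one_if_no_descent[of x] by (metis numbers_one zero_le_one)
  next
    case False
    then obtain i where i: "i \<in> I" "len w = len (s i \<otimes> w) + 1"
      using less.prems ex_descent by blast
    have "s i \<otimes> w = s i \<otimes> x"
      using i less.prems by (intro less.hyps) (auto intro: fire_cong)
    then show ?thesis
      using i less.prems by simp
  qed
qed

section \<open>Longest elements of parabolic subgroups\<close>

lemma play_cong:
  assumes "u \<in> lists J" "\<And>j. j \<in> J \<Longrightarrow> c j = d j" "j \<in> J"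
  shows "play u c j = play u d j"
  using assms(1,3)
proof (induction u arbitrary: j)
  case (Cons i u)
  then show ?case
    using fire_cong[of J "play u c" "play u d"] by simp
qed (use assms in simp)

text \<open>
  The weight that vanishes on \<open>J\<close> and is \<open>1\<close> elsewhere is fixed by \<open>W\<^sub>J\<close>, so its number at \<open>i\<close> stays
  \<open>1\<close>; a descent of \<open>wprod u\<close> at \<open>i\<close> would force it to be at most \<open>0\<close>.
\<close>

lemma parabolic_ascent:
  assumes "J \<subseteq> I" "u \<in> lists J" "i \<in> I" "i \<notin> J"
  shows "0 < ht (wprod u) i"
proof (rule ccontr)
  have u: "u \<in> lists I"
    using assms lists_mono by blast
  define c :: "'i \<Rightarrow> int" where "c j = (if j \<in> J then 0 else 1)" for j
  have "play u c = c"
    using assms(2) by (induction u) (auto simp: fire_def c_def fun_eq_iff)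
  then have fixed: "numbers c (wprod u) i = 1"
    using u assms by (simp add: numbers_wprod c_def)
  assume "\<not> ?thesis"
  then have "len (s i \<otimes> wprod u) < len (s i \<otimes> (s i \<otimes> wprod u))"
    using ht_nonzero[of "wprod u" i] descent_iff[of "wprod u" i] u assms by simp
  then have "0 \<le> numbers c (s i \<otimes> wprod u) i"
    using u assms by (intro numbers_ge_if_ascent) (auto simp: c_def)
  then show False
    using fixed u assms by (simp add: fire_def)
qed

lemma play_uminus: "play u (\<lambda>i. - c i) = (\<lambda>i. - play u c i)"
  by (induction u) (auto simp: fire_def)

text \<open>
  Put \<open>x = wprod v \<otimes> inv (wprod u)\<close>. Starting from the negatives of the numbers of \<open>wprod u\<close>, which are
  positive on \<open>J\<close>, the element \<open>x\<close> of \<open>W\<^sub>J\<close> leads to the negatives of the numbers of \<open>wprod v\<close>, which are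
  again positive on \<open>J\<close>. So \<open>x\<close> has no descent in \<open>J\<close>, and by \<open>parabolic_ascent\<close> none elsewhere.
\<close>

lemma parabolic_longest_unique:
  assumes "J \<subseteq> I" "u \<in> lists J" "v \<in> lists J"
    and "\<And>j. j \<in> J \<Longrightarrow> ht (wprod u) j < 0" "\<And>j. j \<in> J \<Longrightarrow> ht (wprod v) j < 0"
  shows "wprod u = wprod v"
proof -
  have uv: "u \<in> lists I" "v \<in> lists I" "rev u \<in> lists J" "rev u \<in> lists I"
    using assms lists_mono by (auto simp: lists_eq_set)
  have rev: "wprod (rev u) \<otimes> wprod u = \<one>"
    using uv(1)
  proof (induction u)
    case (Cons i u)
    then have "rev u \<in> lists I" by (auto simp: lists_eq_set)
    then show ?case
      using Cons by (simp add: wprod_append m_assoc)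
  qed simp
  define x where "x = v @ rev u"
  have x: "x \<in> lists J" "x \<in> lists I" "wprod x \<otimes> wprod u = wprod v"
    using uv assms rev by (auto simp: x_def wprod_append m_assoc)
  \<comment> \<open>Outside \<open>J\<close> any positive value will do: the numbers on \<open>J\<close> never depend on it.\<close>
  define c where "c j = (if j \<in> J then - ht (wprod u) j else 1)" for j
  have c: "1 \<le> c j" for j
    using assms(4)[of j] by (auto simp: c_def)
  have cj: "numbers c (wprod x) j = - ht (wprod v) j" if "j \<in> J" for j
  proof -
    have "numbers c (wprod x) j = play x (\<lambda>i. - ht (wprod u) i) j"
      using x that by (simp add: numbers_wprod play_cong[of x J c "\<lambda>i. - ht (wprod u) i"] c_def)
    also have "\<dots> = - ht (wprod v) j"
      using numbers_mult[of x "wprod u"] x uv by (simp add: play_uminus)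
    finally show ?thesis .
  qed
  have "wprod x = \<one>"
  proof (rule ccontr)
    assume "wprod x \<noteq> \<one>"
    then obtain i where i: "i \<in> I" "len (wprod x) = len (s i \<otimes> wprod x) + 1"
      using ex_descent[of "wprod x"] x by auto
    then have "ht (wprod x) i < 0"
      using descent_iff[of "wprod x" i] x by simp
    then have "i \<in> J"
      using parabolic_ascent[OF assms(1) x(1) i(1)] by linarith
    have "1 \<le> numbers c (s i \<otimes> wprod x) i"
      using i x c by (intro numbers_ge_if_ascent) auto
    then show False
      using cj[OF \<open>i \<in> J\<close>] assms(5)[OF \<open>i \<in> J\<close>] x i by (simp add: fire_def)
  qed
  then show ?thesis
    using x uv by simp
qed

lemma longest_elt_word:
  assumes fin: "finite (carrier G)" and "J \<subseteq> I"
  obtains u where "u \<in> lists J" "longest_elt G I s J = wprod u" "\<And>j. j \<in> J \<Longrightarrow> ht (wprod u) j < 0"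
proof -
  let ?W = "generate G (s ` J)"
  let ?max = "is_arg_max len (\<lambda>w. w \<in> ?W)"
  have W: "?W = wprod ` lists J"
    using assms generate_eq_words by blast
  have JI: "v \<in> lists I" if "v \<in> lists J" for v
    using that assms lists_mono by blast
  have "?W \<subseteq> carrier G"
    using assms by (intro generate_incl) auto
  then have W_fin: "finite ?W"
    using fin by (rule finite_subset)
  moreover have "?W \<noteq> {}"
    using generate.one[of G "s ` J"] by force
  ultimately have "Max (len ` ?W) \<in> len ` ?W"
    by (intro Max_in) auto
  then obtain w where "w \<in> ?W" "len w = Max (len ` ?W)"
    by auto
  then have w: "?max w"
    using W_fin by (auto simp: is_arg_max_linorder)
  have max: "\<exists>v\<in>lists J. x = wprod v \<and> (\<forall>j\<in>J. ht (wprod v) j < 0)" if "?max x" for x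
  proof -
    have "x \<in> wprod ` lists J"
      using that unfolding W is_arg_max_def by blast
    then obtain v where v: "v \<in> lists J" "x = wprod v"
      by blast
    have "ht (wprod v) j < 0" if j: "j \<in> J" for j
    proof -
      have "wprod (j # v) \<in> ?W"
        unfolding W using v(1) j by (intro imageI) simp
      then have "len (s j \<otimes> wprod v) \<le> len (wprod v)"
        using \<open>?max x\<close> v by (simp add: is_arg_max_linorder)
      then show ?thesis
        using ascent_iff[of "wprod v" j] ht_nonzero[of "wprod v" j] JI[OF v(1)] j assms(2)
        by (metis linorder_neqE_linordered_idom leD subsetD wprod_closed)
    qed
    then show ?thesis
      using v by blast
  qed
  have "longest_elt G I s J = w"
    unfolding longest_elt_def
  proof (rule the_equality)
    show "x = w" if "?max x" for x
      using max[OF that] max[OF w] parabolic_longest_unique[OF assms(2)] by metis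
  qed (rule w)
  then show ?thesis
    using max[OF w] that by blast
qed

lemma longest_elt_eqI:
  assumes "finite (carrier G)" "J \<subseteq> I" "u \<in> lists J" "\<And>j. j \<in> J \<Longrightarrow> ht (wprod u) j < 0"
  shows "longest_elt G I s J = wprod u"
proof -
  obtain v where "v \<in> lists J" "longest_elt G I s J = wprod v" "\<And>j. j \<in> J \<Longrightarrow> ht (wprod v) j < 0"
    using longest_elt_word[OF assms(1,2)] by blast
  then show ?thesis
    using parabolic_longest_unique[of J v u] assms by simp
qed

lemma longest_elt_closed:
  assumes "finite (carrier G)" "J \<subseteq> I"
  shows "longest_elt G I s J \<in> carrier G"
proof (rule longest_elt_word[OF assms])
  fix u assume "u \<in> lists J" "longest_elt G I s J = wprod u"
  then show ?thesis
    using wprod_closed[OF subsetD[OF lists_mono[OF assms(2)]]] by simp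
qed

text \<open>
  The descents of the longest element of \<open>W\<^sub>J\<close> are exactly the nodes of \<open>J\<close>.
\<close>

lemma longest_elt_inj:
  assumes "finite (carrier G)" "J \<subseteq> I" "K \<subseteq> I" "longest_elt G I s J = longest_elt G I s K"
  shows "J = K"
proof -
  have *: "J = {i \<in> I. ht (longest_elt G I s J) i < 0}" if J: "J \<subseteq> I" for J
  proof -
    obtain u where "u \<in> lists J" "longest_elt G I s J = wprod u" "\<And>j. j \<in> J \<Longrightarrow> ht (wprod u) j < 0"
      using longest_elt_word[OF assms(1) J] by blast
    then show ?thesis
      using parabolic_ascent[OF J, of u] J by force
  qed
  show ?thesis
    using *[OF assms(2)] *[OF assms(3)] assms(4) by simp
qed

section \<open>Demazure operators and Matsumoto's theorem\<close>

text \<open>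
  Since \<open>w\<close> and \<open>s\<^sub>i w\<close> are comparable in the Bruhat order, the longer of the two is the larger one, and
  lengths suffice to define \<open>s\<^sub>i \<ast> w\<close>.
\<close>

definition demazure :: "'i \<Rightarrow> 'a \<Rightarrow> 'a" where
  "demazure i w = (if len w < len (s i \<otimes> w) then s i \<otimes> w else w)"

definition demazure_word :: "'i list \<Rightarrow> 'a \<Rightarrow> 'a" where
  "demazure_word u w = foldr demazure u w"

lemma demazure_word_simps [simp]:
  "demazure_word [] w = w"
  "demazure_word (i # u) w = demazure i (demazure_word u w)"
  "demazure_word (u @ v) w = demazure_word u (demazure_word v w)"
  by (simp_all add: demazure_word_def)

lemma demazure_closed [simp]: "i \<in> I \<Longrightarrow> w \<in> carrier G \<Longrightarrow> demazure i w \<in> carrier G"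
  by (simp add: demazure_def)

lemma demazure_word_closed [simp]: "u \<in> lists I \<Longrightarrow> w \<in> carrier G \<Longrightarrow> demazure_word u w \<in> carrier G"
  by (induction u) auto

lemma demazure_ht:
  assumes "i \<in> I" "w \<in> carrier G"
  shows "demazure i w = (if 0 < ht w i then s i \<otimes> w else w)"
  using ascent_iff[of w i] assms by (simp add: demazure_def)

lemma demazure_idem: "i \<in> I \<Longrightarrow> w \<in> carrier G \<Longrightarrow> demazure i (demazure i w) = demazure i w"
  by (simp add: demazure_ht fire_def)

text \<open>
  Both sides climb to the top of the coset of \<open>w\<close> under the dihedral group of \<open>i\<close> and \<open>j\<close>. Which letters
  act is decided by the signs of the numbers of \<open>w\<close> at \<open>i\<close> and \<open>j\<close> and of their sum.
\<close>

lemma demazure_braid: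
  assumes "i \<in> I" "j \<in> I" "i \<noteq> j" "w \<in> carrier G"
  shows "demazure_word (alt_word i j (m i j)) w = demazure_word (alt_word j i (m i j)) w"
proof -
  have neq: "ht w i \<noteq> 0" "ht w j \<noteq> 0" "ht (s i \<otimes> w) j \<noteq> 0"
    using ht_nonzero[of w i] ht_nonzero[of w j] ht_nonzero[of "s i \<otimes> w" j] assms by simp_all
  consider "m i j = 2" "m j i = 2" | "m i j = 3" "m j i = 3"
    using laced m_sym assms by metis
  then show ?thesis
  proof cases
    case 1
    then show ?thesis
      using assms s_commute[of i j w]
      by (simp add: numeral_eq_Suc demazure_ht fire_def)
  next
    case 2
    then show ?thesis
      using assms neq s_braid[of i j w]
      by (simp add: numeral_eq_Suc demazure_ht fire_def)
  qed
qed

lemma demazure_word_reduced: "reduced_expr G I s w u \<Longrightarrow> demazure_word u \<one> = w"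
proof (induction u arbitrary: w)
  case Nil
  then show ?case by (simp add: reduced_expr_def)
next
  case (Cons i u)
  note * = reduced_Cons[OF Cons.prems]
  have "demazure_word u \<one> = s i \<otimes> w"
    using Cons.IH *(4) by blast
  then show ?case
    using *(1-3,5) Cons.prems by (auto simp: demazure_def reduced_expr_def)
qed

text \<open>
  Let the two reduced words begin with \<open>i \<noteq> j\<close>. Then \<open>i\<close> and \<open>j\<close> are descents of \<open>w\<close>, so the numbers of
  \<open>w\<close> at \<open>i\<close> and \<open>j\<close> are negative, and firing them shows that a reduced word of \<open>w\<close> may begin with
  either of the two alternating words of length \<open>m i j\<close>. By induction each given word has the
  value of such a word with the same first letter, and the braid relation compares these two.
\<close>

theorem matsumoto:
  fixes M :: "('c, 'd) monoid_scheme"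
  assumes M: "Group.monoid M" and f: "f \<in> I \<rightarrow> carrier M"
    and braid: "\<And>i j. i \<in> I \<Longrightarrow> j \<in> I \<Longrightarrow> i \<noteq> j \<Longrightarrow>
      word_prod M f (alt_word i j (m i j)) = word_prod M f (alt_word j i (m i j))"
    and "reduced_expr G I s w u" "reduced_expr G I s w v"
  shows "word_prod M f u = word_prod M f v"
  using assms(4,5)
proof (induction "length u" arbitrary: w u v rule: less_induct)
  case less
  interpret M: Group.monoid M by fact
  have fc: "i \<in> I \<Longrightarrow> f i \<in> carrier M" for i
    using f by auto
  have lens: "length u = len w" "length v = len w" and uv: "u \<in> lists I" "v \<in> lists I"
    using less.prems by (auto simp: reduced_expr_def)
  have w: "w \<in> carrier G"
    using less.prems(1) wprod_closed unfolding reduced_expr_def by blast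
  show ?case
  proof (cases u)
    case Nil
    then show ?thesis using lens by simp
  next
    case (Cons i u')
    then obtain j v' where v: "v = j # v'"
      using lens by (cases v) auto
    note u = Cons
    note ui = reduced_Cons[OF less.prems(1)[unfolded u]]
    note vj = reduced_Cons[OF less.prems(2)[unfolded v]]
    have closed: "u' \<in> lists I" "v' \<in> lists I"
      using uv u v by auto
    have IHu: "word_prod M f u' = word_prod M f x" if "reduced_expr G I s (s i \<otimes> w) x" for x
      using less.hyps[OF _ ui(4) that] u by simp
    have IHv: "word_prod M f v' = word_prod M f x" if "reduced_expr G I s (s j \<otimes> w) x" for x
      using less.hyps[OF _ vj(4) that] v lens by simp
    show ?thesis
    proof (cases "i = j")
      case True
      then show ?thesis
        using IHu[of v'] u v vj by simp
    next
      case False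
      have h: "ht w i < 0" "ht w j < 0"
        using descent_iff[OF w ui(1)] descent_iff[OF w vj(1)] ui(5) vj(5) by blast+
      have descent: "len x = len (s k \<otimes> x) + 1" if "ht x k < 0" "k \<in> I" "x \<in> carrier G" for k x
        using descent_iff that by blast
      consider "m i j = 2" "m j i = 2" | "m i j = 3" "m j i = 3"
        using laced m_sym ui(1) vj(1) False by metis
      then show ?thesis
      proof cases
        case 1
        define x where "x = s j \<otimes> (s i \<otimes> w)"
        have x: "x \<in> carrier G" "x = s i \<otimes> (s j \<otimes> w)"
          using w ui(1) vj(1) 1 s_commute by (auto simp: x_def)
        obtain r where r: "reduced_expr G I s x r"
          using x ex_reduced_expr by blast
        have rc: "r \<in> lists I"
          using r by (simp add: reduced_expr_def)
        have "len (s i \<otimes> w) = len x + 1"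
          unfolding x_def using descent[of "s i \<otimes> w" j] w ui(1) vj(1) 1 h False
          by (simp add: fire_def)
        then have "reduced_expr G I s (s i \<otimes> w) (j # r)"
          using Cons_reduced[of j x r] r x(1) w ui(1) vj(1) by (simp add: x_def)
        moreover have "len (s j \<otimes> w) = len x + 1"
          unfolding x(2) using descent[of "s j \<otimes> w" i] w ui(1) vj(1) 1 h False
          by (simp add: fire_def)
        then have "reduced_expr G I s (s j \<otimes> w) (i # r)"
          using Cons_reduced[of i x r] r x(1) w ui(1) vj(1) by (simp add: x(2))
        ultimately have "word_prod M f u = f i \<otimes>\<^bsub>M\<^esub> (f j \<otimes>\<^bsub>M\<^esub> word_prod M f r)"
          "word_prod M f v = f j \<otimes>\<^bsub>M\<^esub> (f i \<otimes>\<^bsub>M\<^esub> word_prod M f r)"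
          using IHu IHv u v by auto
        then show ?thesis
          using braid[of i j] 1 False ui(1) vj(1) fc M.word_prod_closed[OF f rc]
          by (simp add: numeral_eq_Suc flip: M.m_assoc)
      next
        case 2
        define x where "x = s i \<otimes> (s j \<otimes> (s i \<otimes> w))"
        have x: "x \<in> carrier G" "x = s j \<otimes> (s i \<otimes> (s j \<otimes> w))"
          using w ui(1) vj(1) 2 s_braid[of i j w] by (auto simp: x_def)
        obtain r where r: "reduced_expr G I s x r"
          using x ex_reduced_expr by blast
        have rc: "r \<in> lists I"
          using r by (simp add: reduced_expr_def)
        have red: "reduced_expr G I s (s a \<otimes> w) (b # a # r)"
          if "a \<in> I" "b \<in> I" "m a b = 3" "m b a = 3" "a \<noteq> b" "ht w a < 0" "ht w b < 0"
            "x = s a \<otimes> (s b \<otimes> (s a \<otimes> w))" for a b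
        proof -
          have "len (s a \<otimes> w) = len (s b \<otimes> (s a \<otimes> w)) + 1"
            using descent[of "s a \<otimes> w" b] that w by (simp add: fire_def)
          moreover have "len (s b \<otimes> (s a \<otimes> w)) = len x + 1"
            using descent[of "s b \<otimes> (s a \<otimes> w)" a] that w by (simp add: fire_def)
          ultimately show ?thesis
            using Cons_reduced[of a x r] Cons_reduced[of b "s a \<otimes> x" "a # r"] r that w by simp
        qed
        have "word_prod M f u = f i \<otimes>\<^bsub>M\<^esub> (f j \<otimes>\<^bsub>M\<^esub> (f i \<otimes>\<^bsub>M\<^esub> word_prod M f r))"
          using IHu[OF red[of i j]] ui(1) vj(1) 2 False h u by (simp add: x_def)
        moreover have "word_prod M f v = f j \<otimes>\<^bsub>M\<^esub> (f i \<otimes>\<^bsub>M\<^esub> (f j \<otimes>\<^bsub>M\<^esub> word_prod M f r))"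
          using IHv[OF red[of j i]] ui(1) vj(1) 2 False h v x(2) by simp
        moreover have "f i \<otimes>\<^bsub>M\<^esub> f j \<otimes>\<^bsub>M\<^esub> f i = f j \<otimes>\<^bsub>M\<^esub> f i \<otimes>\<^bsub>M\<^esub> f j"
          using braid[of i j] 2 False ui(1) vj(1) fc by (simp add: numeral_eq_Suc M.m_assoc)
        ultimately show ?thesis
          using ui(1) vj(1) fc M.word_prod_closed[OF f rc]
          by (simp flip: M.m_assoc)
      qed
    qed
  qed
qed

end

section \<open>The product in the 0-Hecke algebra\<close>

lemma free_algebra_simps [simp]:
  "carrier (free_algebra I) = {p. Poly_Mapping.keys p \<subseteq> FMon ` lists I}"
  "x \<otimes>\<^bsub>free_algebra I\<^esub> y = x * y" "\<one>\<^bsub>free_algebra I\<^esub> = 1"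
  "x \<oplus>\<^bsub>free_algebra I\<^esub> y = x + y" "\<zero>\<^bsub>free_algebra I\<^esub> = 0"
  by (simp_all add: free_algebra_def)

lemma free_algebra_keys:
  "p \<in> carrier (free_algebra I) \<Longrightarrow> a \<in> Poly_Mapping.keys p \<Longrightarrow> a \<in> FMon ` lists I"
  unfolding free_algebra_simps mem_Collect_eq by (rule subsetD)

lemma free_algebra_mult_closed:
  assumes "p \<in> carrier (free_algebra I)" "q \<in> carrier (free_algebra I)"
  shows "p * q \<in> carrier (free_algebra I)"
proof -
  have "a + b \<in> FMon ` lists I" if "a \<in> FMon ` lists I" "b \<in> FMon ` lists I" for a b
    using that by (auto simp: image_iff)
  then have "{a + b | a b. a \<in> Poly_Mapping.keys p \<and> b \<in> Poly_Mapping.keys q} \<subseteq> FMon ` lists I"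
  proof clarify
    fix a b assume "a \<in> Poly_Mapping.keys p" "b \<in> Poly_Mapping.keys q"
    then have "a \<in> FMon ` lists I" "b \<in> FMon ` lists I"
      using assms free_algebra_keys by blast+
    then show "a + b \<in> FMon ` lists I"
      by fact
  qed
  then show ?thesis
    using keys_mult[of p q] by simp
qed

lemma ring_free_algebra: "ring (free_algebra I)"
proof (intro ringI abelian_groupI monoidI)
  fix x y z
  assume x: "x \<in> carrier (free_algebra I)" and y: "y \<in> carrier (free_algebra I)"
  show "x \<otimes>\<^bsub>free_algebra I\<^esub> y \<in> carrier (free_algebra I)"
    using free_algebra_mult_closed[OF x y] by simp
  show "x \<oplus>\<^bsub>free_algebra I\<^esub> y \<in> carrier (free_algebra I)"
    using x y keys_add[of x y] by auto
  show "\<exists>y\<in>carrier (free_algebra I). y \<oplus>\<^bsub>free_algebra I\<^esub> x = \<zero>\<^bsub>free_algebra I\<^esub>"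
    using x by (intro bexI[of _ "- x"]) auto
qed (auto simp: zero_fmon_def algebra_simps)

lemma minus_free_algebra:
  assumes "p \<in> carrier (free_algebra I)" "q \<in> carrier (free_algebra I)"
  shows "p \<ominus>\<^bsub>free_algebra I\<^esub> q = p - q"
proof -
  interpret R: ring "free_algebra I" by (rule ring_free_algebra)
  have "- q \<in> carrier (free_algebra I)"
    using assms by simp
  then have "\<ominus>\<^bsub>free_algebra I\<^esub> q = - q"
    using assms R.minus_equality[of "- q" q] by simp
  then show ?thesis
    by (simp add: a_minus_def)
qed

text \<open>
  The algebra is the monoid algebra of the free monoid, hence products of generators are single
  monomials, and the relations below are differences of two monomials.
\<close>

lemma word_prod_free_gen: "word_prod (free_algebra I) free_gen u = Poly_Mapping.single (FMon u) 1"
  by (induction u) (simp_all add: free_gen_def mult_single flip: zero_fmon_def)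

context simply_laced_coxeter
begin

abbreviation FA :: "('i fmon \<Rightarrow>\<^sub>0 int) ring" where "FA \<equiv> free_algebra I"

fun demazure_fmon :: "'i fmon \<Rightarrow> 'a \<Rightarrow> 'a" where
  "demazure_fmon (FMon u) = demazure_word u"

lemma demazure_fmon_plus: "demazure_fmon (a + b) w = demazure_fmon a (demazure_fmon b w)"
  by (cases a; cases b) simp

text \<open>
  The representation of the free algebra on \<open>\<int>[W]\<close> in which the generators act by the Demazure operators.
\<close>

definition hecke_act :: "('i fmon \<Rightarrow>\<^sub>0 int) \<Rightarrow> 'a \<Rightarrow> 'a \<Rightarrow>\<^sub>0 int" where
  "hecke_act p w = frag_extend (\<lambda>a. frag_of (demazure_fmon a w)) p"

lemma hecke_act_diff: "hecke_act (p - q) w = hecke_act p w - hecke_act q w"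
  by (simp add: hecke_act_def frag_extend_diff)

lemma hecke_act_add: "hecke_act (p + q) w = hecke_act p w + hecke_act q w"
  by (simp add: hecke_act_def frag_extend_add)

lemma hecke_act_single [simp]: "hecke_act (frag_of a) w = frag_of (demazure_fmon a w)"
  by (simp add: hecke_act_def)

text \<open>
  Multiplicativity of the representation, on which the ideal property of its kernel rests.
\<close>

lemma hecke_act_mult: "hecke_act (p * q) w = frag_extend (hecke_act p) (hecke_act q w)"
proof -
  have 1: "hecke_act (frag_of a * q) w = frag_extend (hecke_act (frag_of a)) (hecke_act q w)" for a
  proof (induction q rule: frag_induction[OF subset_UNIV])
    case (2 b)
    have "frag_of a * frag_of b = frag_of (a + b)"
      by (simp add: mult_single)
    then show ?case by (simp add: demazure_fmon_plus)
  next
    case (3 q r)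
    then show ?case by (simp add: hecke_act_diff frag_extend_diff right_diff_distrib)
  qed (simp_all add: hecke_act_def)
  show ?thesis
  proof (induction p rule: frag_induction[OF subset_UNIV])
    case (2 a)
    show ?case by (rule 1)
  next
    case (3 p r)
    have "hecke_act ((p - r) * q) w = hecke_act (p * q) w - hecke_act (r * q) w"
      by (simp add: left_diff_distrib hecke_act_diff)
    moreover have "frag_extend (hecke_act (p - r)) x = frag_extend (hecke_act p) x - frag_extend (hecke_act r) x" for x
      by (induction x rule: frag_induction[OF subset_UNIV])
        (simp_all add: hecke_act_diff frag_extend_diff)
    ultimately show ?case
      using 3 by simp
  qed (simp_all add: hecke_act_def frag_extend_def)
qed

lemma keys_hecke_act:
  assumes "p \<in> carrier FA" "w \<in> carrier G"
  shows "Poly_Mapping.keys (hecke_act p w) \<subseteq> carrier G"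
proof -
  have "Poly_Mapping.keys (hecke_act p w) \<subseteq> (\<Union>a\<in>Poly_Mapping.keys p. {demazure_fmon a w})"
    unfolding hecke_act_def using keys_frag_extend[of "\<lambda>a. frag_of (demazure_fmon a w)" p] by auto
  moreover have "demazure_fmon a w \<in> carrier G" if a: "a \<in> Poly_Mapping.keys p" for a
  proof -
    obtain u where "u \<in> lists I" "a = FMon u"
      using free_algebra_keys[OF assms(1) a] by blast
    then show ?thesis using assms(2) by simp
  qed
  ultimately show ?thesis by blast
qed

definition hecke_act_kernel :: "('i fmon \<Rightarrow>\<^sub>0 int) set" where
  "hecke_act_kernel = {p \<in> carrier FA. \<forall>w\<in>carrier G. hecke_act p w = 0}"

lemma ideal_hecke_act_kernel: "ideal hecke_act_kernel FA"
proof -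
  interpret R: ring FA by (rule ring_free_algebra)
  have "subgroup hecke_act_kernel (add_monoid FA)"
  proof (rule R.add.subgroupI)
    show "hecke_act_kernel \<subseteq> carrier FA" by (auto simp: hecke_act_kernel_def)
    show "hecke_act_kernel \<noteq> {}" by (auto simp: hecke_act_kernel_def hecke_act_def intro: exI[of _ 0])
  next
    fix p assume p: "p \<in> hecke_act_kernel"
    have "\<ominus>\<^bsub>FA\<^esub> p = - p"
      using p R.minus_equality[of "- p" p] by (simp add: hecke_act_kernel_def)
    then show "\<ominus>\<^bsub>FA\<^esub> p \<in> hecke_act_kernel"
      using p hecke_act_diff[of 0 p] by (auto simp: hecke_act_kernel_def) (auto simp: hecke_act_def)
  next
    fix p q assume "p \<in> hecke_act_kernel" "q \<in> hecke_act_kernel"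
    then show "p \<oplus>\<^bsub>FA\<^esub> q \<in> hecke_act_kernel"
      using R.a_closed[of p q] by (auto simp: hecke_act_kernel_def hecke_act_add)
  qed
  then show ?thesis
  proof (rule idealI[OF ring_free_algebra])
    fix p x assume p: "p \<in> hecke_act_kernel" and x: "x \<in> carrier FA"
    have "hecke_act (x * p) w = 0" if "w \<in> carrier G" for w
      using p that by (simp add: hecke_act_mult hecke_act_kernel_def)
    then show "x \<otimes>\<^bsub>FA\<^esub> p \<in> hecke_act_kernel"
      using p x R.m_closed[of x p] by (auto simp: hecke_act_kernel_def)
    have "hecke_act (p * x) w = 0" if w: "w \<in> carrier G" for w
    proof -
      have "hecke_act (p * x) w = frag_extend (\<lambda>_. 0) (hecke_act x w)"
        unfolding hecke_act_mult using keys_hecke_act[OF x w] p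
        by (intro frag_extend_eq) (auto simp: hecke_act_kernel_def)
      then show ?thesis by (simp add: frag_extend_def)
    qed
    then show "p \<otimes>\<^bsub>FA\<^esub> x \<in> hecke_act_kernel"
      using p x R.m_closed[of p x] by (auto simp: hecke_act_kernel_def)
  qed
qed

lemma set_alt_wordD: "k \<in> set (alt_word i j n) \<Longrightarrow> k = i \<or> k = j"
  by (induction i j n rule: alt_word.induct) auto

lemma alt_word_lists: "i \<in> I \<Longrightarrow> j \<in> I \<Longrightarrow> alt_word i j n \<in> lists I"
  by (auto dest: set_alt_wordD)

lemma hecke0_relations_carrier: "hecke0_relations I m \<subseteq> carrier FA"
proof -
  interpret R: ring FA by (rule ring_free_algebra)
  have gen: "free_gen i \<in> carrier FA" if "i \<in> I" for i
    using that by (simp add: free_gen_def)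
  have wp: "word_prod FA free_gen u \<in> carrier FA" if "u \<in> lists I" for u
    using that by (simp add: word_prod_free_gen)
  have diff: "p - q \<in> carrier FA" if "p \<in> carrier FA" "q \<in> carrier FA" for p q
    using that R.minus_closed[of p q] minus_free_algebra[of p I q] by metis
  show ?thesis
    unfolding hecke0_relations_def
    by (auto simp del: free_algebra_simps intro!: diff free_algebra_mult_closed gen wp
        dest: set_alt_wordD)
qed

text \<open>
  The representation factors through the 0-Hecke algebra.
\<close>

lemma hecke0_ideal_subset: "hecke0_ideal I m \<subseteq> hecke_act_kernel"
proof -
  interpret R: ring FA by (rule ring_free_algebra)
  have sq: "free_gen i * free_gen i - free_gen i \<in> hecke_act_kernel" if "i \<in> I" for i
  proof -
    have "hecke_act (free_gen i * free_gen i - free_gen i) w = 0" if "w \<in> carrier G" for w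
      using \<open>i \<in> I\<close> that demazure_idem by (simp add: free_gen_def mult_single hecke_act_diff)
    moreover have "free_gen i * free_gen i - free_gen i \<in> carrier FA"
      using hecke0_relations_carrier that by (auto simp: hecke0_relations_def)
    ultimately show ?thesis by (simp add: hecke_act_kernel_def)
  qed
  have br: "word_prod FA free_gen (alt_word i j (m i j)) - word_prod FA free_gen (alt_word j i (m i j)) \<in> hecke_act_kernel"
    (is "?p \<in> _") if "i \<in> I" "j \<in> I" "i \<noteq> j" for i j
  proof -
    have "hecke_act ?p w = 0" if "w \<in> carrier G" for w
      using demazure_braid[OF \<open>i \<in> I\<close> \<open>j \<in> I\<close> \<open>i \<noteq> j\<close> that] by (simp add: word_prod_free_gen hecke_act_diff)
    moreover have "?p \<in> carrier FA"
      using hecke0_relations_carrier that unfolding hecke0_relations_def by blast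
    ultimately show ?thesis by (simp add: hecke_act_kernel_def)
  qed
  show ?thesis
    unfolding hecke0_ideal_def
    by (rule R.genideal_minimal[OF ideal_hecke_act_kernel]) (use sq br in \<open>auto simp: hecke0_relations_def\<close>)
qed

lemma ideal_hecke0: "ideal (hecke0_ideal I m) FA"
  unfolding hecke0_ideal_def
  by (rule ring.genideal_ideal[OF ring_free_algebra hecke0_relations_carrier])

abbreviation hecke_word :: "'i list \<Rightarrow> ('i fmon \<Rightarrow>\<^sub>0 int) set" where
  "hecke_word \<equiv> word_prod (hecke0 I m) (hecke0_gen I m)"

lemma hecke_word_coset:
  assumes "u \<in> lists I"
  shows "hecke_word u = hecke0_ideal I m +>\<^bsub>FA\<^esub> word_prod FA free_gen u"
  using assms
proof (induction u)
  case Nil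
  then show ?case by (simp add: hecke0_def FactRing_def)
next
  case (Cons i u)
  interpret H: ideal "hecke0_ideal I m" FA by (rule ideal_hecke0)
  have "free_gen i \<in> carrier FA" "word_prod FA free_gen u \<in> carrier FA"
    using Cons by (simp_all add: word_prod_free_gen free_gen_def)
  note * = H.rcoset_mult_add[OF this]
  have mult: "x \<otimes>\<^bsub>hecke0 I m\<^esub> y = rcoset_mult FA (hecke0_ideal I m) x y" for x y
    by (simp add: hecke0_def FactRing_def)
  show ?case
    using Cons * by (simp only: word_prod_Cons mult hecke0_gen_def)
qed

lemma hecke_word_eq_iff:
  assumes "u \<in> lists I" "v \<in> lists I"
  shows "hecke_word u = hecke_word v \<longleftrightarrow> word_prod FA free_gen u - word_prod FA free_gen v \<in> hecke0_ideal I m"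
proof -
  have "word_prod FA free_gen u \<in> carrier FA" "word_prod FA free_gen v \<in> carrier FA"
    using assms by (simp_all add: word_prod_free_gen)
  then show ?thesis
    using ring.quotient_eq_iff_same_a_r_cos[OF ring_free_algebra ideal_hecke0] assms
    by (simp add: hecke_word_coset minus_free_algebra del: free_algebra_simps)
qed

text \<open>
  This separates the elements \<open>T'\<^sub>w\<close>: for a reduced word of \<open>w\<close> the operators take \<open>\<one>\<close> to \<open>w\<close>.
\<close>

lemma demazure_word_eq_if_hecke_word_eq:
  assumes "u \<in> lists I" "v \<in> lists I" "hecke_word u = hecke_word v" "w \<in> carrier G"
  shows "demazure_word u w = demazure_word v w"
proof -
  have "word_prod FA free_gen u - word_prod FA free_gen v \<in> hecke_act_kernel"
    using assms hecke_word_eq_iff hecke0_ideal_subset by blast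
  then have "frag_of (demazure_word u w) = frag_of (demazure_word v w)"
    using assms(4) by (simp add: hecke_act_kernel_def hecke_act_diff word_prod_free_gen)
  then have "Poly_Mapping.keys (frag_of (demazure_word u w)) = Poly_Mapping.keys (frag_of (demazure_word v w))"
    by simp
  then show ?thesis by simp
qed

lemma hecke0_monoid: "Group.monoid (hecke0 I m)"
proof -
  interpret H: ideal "hecke0_ideal I m" FA by (rule ideal_hecke0)
  show ?thesis
    using H.quotient_is_ring by (simp add: hecke0_def ring_def)
qed

lemma hecke0_gen_Pi: "hecke0_gen I m \<in> I \<rightarrow> carrier (hecke0 I m)"
proof
  fix i assume "i \<in> I"
  interpret H: ideal "hecke0_ideal I m" FA by (rule ideal_hecke0)
  have "free_gen i \<in> carrier FA"
    using \<open>i \<in> I\<close> by (simp add: free_gen_def)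
  then show "hecke0_gen I m i \<in> carrier (hecke0 I m)"
    unfolding hecke0_gen_def hecke0_def FactRing_def using H.a_rcosetsI[OF H.a_subset] by simp
qed

lemma hecke_word_append: "u \<in> lists I \<Longrightarrow> v \<in> lists I \<Longrightarrow> hecke_word (u @ v) = hecke_word u \<otimes>\<^bsub>hecke0 I m\<^esub> hecke_word v"
  by (rule monoid.word_prod_append[OF hecke0_monoid hecke0_gen_Pi])

lemma hecke_word_idem:
  assumes "i \<in> I"
  shows "hecke_word [i, i] = hecke_word [i]"
proof -
  have "free_gen i * free_gen i - free_gen i \<in> hecke0_ideal I m"
    unfolding hecke0_ideal_def
    using ring.genideal_self[OF ring_free_algebra hecke0_relations_carrier] assms
    by (auto simp: hecke0_relations_def)
  then show ?thesis
    using assms by (subst hecke_word_eq_iff) auto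
qed

lemma hecke_word_braid:
  assumes "i \<in> I" "j \<in> I" "i \<noteq> j"
  shows "hecke_word (alt_word i j (m i j)) = hecke_word (alt_word j i (m i j))"
proof -
  have "word_prod FA free_gen (alt_word i j (m i j)) - word_prod FA free_gen (alt_word j i (m i j))
      \<in> hecke0_ideal I m"
    unfolding hecke0_ideal_def
    using ring.genideal_self[OF ring_free_algebra hecke0_relations_carrier] assms
    unfolding hecke0_relations_def by blast
  then show ?thesis
    using assms by (simp add: hecke_word_eq_iff alt_word_lists)
qed

lemma hecke_word_reduced:
  assumes "reduced_expr G I s w u" "reduced_expr G I s w v"
  shows "hecke_word u = hecke_word v"
  by (rule matsumoto[OF hecke0_monoid hecke0_gen_Pi hecke_word_braid assms])

text \<open>
  Prepending \<open>i\<close> either extends the reduced word, or \<open>i\<close> is already a descent, and then the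
  reduced word may be chosen to begin with \<open>i\<close>, where the idempotent relation absorbs the new letter.
\<close>

lemma hecke_word_normalise:
  assumes "u \<in> lists I" "reduced_expr G I s (demazure_word u \<one>) r"
  shows "hecke_word u = hecke_word r"
  using assms
proof (induction u arbitrary: r)
  case Nil
  then show ?case by (simp add: reduced_expr_def)
next
  case (Cons i u)
  let ?w = "demazure_word u \<one>"
  interpret H: Group.monoid "hecke0 I m" by (rule hecke0_monoid)
  have i: "i \<in> I" and u: "u \<in> lists I"
    using Cons.hyps by simp_all
  then have w: "?w \<in> carrier G"
    by simp
  show ?case
  proof (cases "len ?w < len (s i \<otimes> ?w)")
    case True
    obtain q where q: "reduced_expr G I s ?w q"
      using w ex_reduced_expr by blast
    have "reduced_expr G I s (s i \<otimes> ?w) (i # q)"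
      using True q i w len_s_cases[of i ?w] by (intro Cons_reduced) auto
    then show ?thesis
      using hecke_word_reduced[of _ "i # q" r] Cons.prems Cons.IH[OF q] True by (simp add: demazure_def)
  next
    case False
    then have d: "len ?w = len (s i \<otimes> ?w) + 1"
      using i w len_s_cases[of i ?w] by auto
    obtain q where q: "reduced_expr G I s (s i \<otimes> ?w) q"
      using w i ex_reduced_expr by (metis s_closed m_closed)
    have iq: "reduced_expr G I s ?w (i # q)"
      using Cons_reduced[of i "s i \<otimes> ?w" q] d q i w by simp
    have ql: "q \<in> lists I"
      using q by (simp add: reduced_expr_def)
    have "hecke_word (i # u) = hecke_word ([i, i] @ q)"
      using Cons.IH[OF iq] by simp
    also have "\<dots> = hecke_word ([i] @ q)"
      using hecke_word_append[of "[i, i]" q] hecke_word_append[of "[i]" q] hecke_word_idem[OF i] i ql by simp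
    also have "\<dots> = hecke_word r"
      using hecke_word_reduced[of ?w "i # q" r] iq Cons.prems False by (simp add: demazure_def)
    finally show ?thesis .
  qed
qed

text \<open>
  The word \<open>u\<close> need not be reduced, so a word found by playing the game serves as it stands.
\<close>

theorem cox_ast_demazure_word:
  assumes "u \<in> lists I" "y \<in> carrier G"
  shows "cox_ast G I s m (demazure_word u \<one>) y = demazure_word u y"
proof -
  let ?T = "hecke0_basis G I s m"
  have T: "\<exists>r. reduced_expr G I s w r \<and> ?T w = hecke_word r" if "w \<in> carrier G" for w
    using someI_ex[of "reduced_expr G I s w"] ex_reduced_expr[OF that]
    unfolding hecke0_basis_def by metis
  obtain p where p: "reduced_expr G I s (demazure_word u \<one>) p" "?T (demazure_word u \<one>) = hecke_word p"
    using T assms demazure_word_closed one_closed by blast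
  obtain q where q: "reduced_expr G I s y q" "?T y = hecke_word q"
    using T assms by blast
  have pq: "p \<in> lists I" "q \<in> lists I"
    using p q by (auto simp: reduced_expr_def)
  have prod: "?T (demazure_word u \<one>) \<otimes>\<^bsub>hecke0 I m\<^esub> ?T y = hecke_word (u @ q)"
    using p(2) q(2) hecke_word_normalise[OF assms(1) p(1)] assms(1) pq by (simp add: hecke_word_append)
  have uq: "demazure_word (u @ q) \<one> = demazure_word u y"
    using demazure_word_reduced[OF q(1)] by simp
  show ?thesis
    unfolding cox_ast_def
  proof (rule the_equality)
    obtain r where r: "reduced_expr G I s (demazure_word u y) r" "?T (demazure_word u y) = hecke_word r"
      using T assms demazure_word_closed by blast
    then show "demazure_word u y \<in> carrier G \<and>
        ?T (demazure_word u \<one>) \<otimes>\<^bsub>hecke0 I m\<^esub> ?T y = ?T (demazure_word u y)"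
      using hecke_word_normalise[of "u @ q" r] uq prod assms pq by simp
  next
    fix z assume z: "z \<in> carrier G \<and> ?T (demazure_word u \<one>) \<otimes>\<^bsub>hecke0 I m\<^esub> ?T y = ?T z"
    then obtain r where r: "reduced_expr G I s z r" "?T z = hecke_word r"
      using T by blast
    then have "demazure_word (u @ q) \<one> = demazure_word r \<one>"
      using z prod assms pq by (intro demazure_word_eq_if_hecke_word_eq) (auto simp: reduced_expr_def)
    then show "z = demazure_word u y"
      using demazure_word_reduced[OF r(1)] uq by simp
  qed
qed

end

section \<open>Reading off the operation on subsets\<close>

context simply_laced_coxeter
begin

lemma demazure_word_parabolic:
  assumes "J \<subseteq> I" "u \<in> lists J"
  shows "demazure_word u \<one> \<in> wprod ` lists J"
  using assms(2)
proof (induction u)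
  case Nil
  show ?case by (rule image_eqI[of _ _ "[]"]) auto
next
  case (Cons i u)
  then obtain v where "v \<in> lists J" "demazure_word u \<one> = wprod v" by auto
  then have "demazure i (demazure_word u \<one>) \<in> {wprod v, wprod (i # v)}" "v \<in> lists J" "i # v \<in> lists J"
    using Cons.hyps by (simp_all add: demazure_def)
  then show ?case
    by (metis demazure_word_simps(2) image_eqI insert_iff singletonD)
qed

text \<open>
  Multiplying \<open>w\<^sub>I\<close> by \<open>w\<^sub>J\<close> plays the word of \<open>w\<^sub>J\<close> from the negatives of the start, and the game is linear.
\<close>

lemma ht_longest_mult:
  assumes fin: "finite (carrier G)" and "J \<subseteq> I" "i \<in> I"
    and w0: "\<And>i. i \<in> I \<Longrightarrow> ht (longest_elt G I s I) i = - 1"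
  shows "ht (longest_elt G I s J \<otimes> longest_elt G I s I) i = - ht (longest_elt G I s J) i"
proof (rule longest_elt_word[OF fin assms(2)])
  fix u assume u: "u \<in> lists J" "longest_elt G I s J = wprod u"
  let ?w = "longest_elt G I s I"
  have uI: "u \<in> lists I"
    using subsetD[OF lists_mono[OF assms(2)] u(1)] .
  have "ht (wprod u \<otimes> ?w) i = play u (\<lambda>_. - 1) i"
    using play_cong[of u I "ht ?w" "\<lambda>_. - 1" i] numbers_mult[of u ?w] uI w0 assms(3)
      longest_elt_closed[OF fin subset_refl] by simp
  then show ?thesis
    using play_uminus[of u "\<lambda>_. 1"] uI u by (simp add: numbers_wprod)
qed

lemma cox_star_eqI:
  assumes fin: "finite (carrier G)" and K: "K \<subseteq> I" and I: "J1 \<subseteq> I" "J2 \<subseteq> I"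
    and u: "u \<in> lists I"
    and x: "demazure_word u \<one> = longest_elt G I s J1 \<otimes> longest_elt G I s I"
    and y: "demazure_word u (longest_elt G I s J2 \<otimes> longest_elt G I s I) = longest_elt G I s K \<otimes> longest_elt G I s I"
  shows "cox_star G I s m J1 J2 = K"
proof -
  note closed = longest_elt_closed[OF fin]
  have ast: "cox_ast G I s m (longest_elt G I s J1 \<otimes> longest_elt G I s I)
      (longest_elt G I s J2 \<otimes> longest_elt G I s I) = longest_elt G I s K \<otimes> longest_elt G I s I"
    using cox_ast_demazure_word[OF u, of "longest_elt G I s J2 \<otimes> longest_elt G I s I"] closed I x y by simp
  show ?thesis
    unfolding cox_star_def ast
  proof (rule the_equality)
    fix L assume L: "L \<subseteq> I \<and> longest_elt G I s K \<otimes> longest_elt G I s I = longest_elt G I s L \<otimes> longest_elt G I s I"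
    then have "longest_elt G I s K = longest_elt G I s L"
      using K closed by (intro r_cancel[OF conjunct2[OF L]]) auto
    then show "L = K"
      using longest_elt_inj[OF fin K, of L] L by simp
  qed (use K in simp)
qed

end

section \<open>The numbers game on the diagram of type E6\<close>

type_synonym state6 = "int \<times> int \<times> int \<times> int \<times> int \<times> int"

fun fire6 :: "nat \<Rightarrow> state6 \<Rightarrow> state6" where
  "fire6 i (a, b, c, d, e, f) =
    (if i = 1 then (- a, b, c + a, d, e, f)
     else if i = 2 then (a, - b, c, d + b, e, f)
     else if i = 3 then (a + c, b, - c, d + c, e, f)
     else if i = 4 then (a, b + d, c + d, - d, e + d, f)
     else if i = 5 then (a, b, c, d + e, - e, f + e)
     else (a, b, c, d, e + f, - f))"

fun at6 :: "state6 \<Rightarrow> nat \<Rightarrow> int" where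
  "at6 (a, b, c, d, e, f) i =
    (if i = 1 then a else if i = 2 then b else if i = 3 then c else if i = 4 then d
     else if i = 5 then e else f)"

definition demazure6 :: "nat \<Rightarrow> state6 \<Rightarrow> state6" where
  "demazure6 i x = (if 0 < at6 x i then fire6 i x else x)"


definition start6 :: state6 where "start6 = (1, 1, 1, 1, 1, 1)"

fun neg6 :: "state6 \<Rightarrow> state6" where
  "neg6 (a, b, c, d, e, f) = (- a, - b, - c, - d, - e, - f)"

definition nodes6 :: "nat list" where "nodes6 = [1, 2, 3, 4, 5, 6]"

primrec demazure_word6 :: "nat list \<Rightarrow> state6 \<Rightarrow> state6" where
  "demazure_word6 [] x = x"
| "demazure_word6 (i # u) x = demazure6 i (demazure_word6 u x)"

text \<open>
  Runs through \<open>J\<close> twelve times, the Coxeter number of \<open>E\<^sub>6\<close>. That the Demazure operators have reached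
  the longest element by then is confirmed by \<open>longest6_negative\<close>.
\<close>

definition longest6 :: "nat list \<Rightarrow> state6" where
  "longest6 J = demazure_word6 (concat (replicate 12 J)) start6"

text \<open>
  A reduced word is read off by firing negative numbers until none is left; 36 is the number of
  positive roots, hence enough as bound \<open>n\<close>.
\<close>

primrec descent_word6 :: "nat \<Rightarrow> state6 \<Rightarrow> nat list" where
  "descent_word6 0 x = []"
| "descent_word6 (Suc n) x =
    (case find (\<lambda>i. at6 x i < 0) nodes6 of None \<Rightarrow> [] | Some i \<Rightarrow> i # descent_word6 n (fire6 i x))"

definition adjacent6 :: "nat \<Rightarrow> nat \<Rightarrow> bool" where
  "adjacent6 i j \<longleftrightarrow> (i, j) \<in> set [(1, 3), (3, 1), (3, 4), (4, 3), (4, 5), (5, 4), (5, 6), (6, 5), (2, 4), (4, 2)]"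

definition separated6 :: "nat list \<Rightarrow> bool" where
  "separated6 J \<longleftrightarrow> (\<exists>A\<in>set (subseqs J). A \<noteq> [] \<and> \<not> set J \<subseteq> set A \<and>
     (\<forall>a\<in>set A. \<forall>b\<in>set J. b \<in> set A \<or> \<not> adjacent6 a b))"

definition connected6 :: "nat list list" where
  "connected6 = filter (\<lambda>J. J \<noteq> nodes6 \<and> \<not> separated6 J) (subseqs nodes6)"

text \<open>
  Both orders of each pair occur, because the check runs over all ordered pairs.
\<close>

definition star6 :: "nat list \<Rightarrow> nat list \<Rightarrow> nat list" where
  "star6 A B = (case map_of
     [(([2,3,4,5,6], [1,3,4,5,6]), [4,6]), (([1,3,4,5,6], [2,3,4,5,6]), [4,6]),
      (([1,2,3,4,5], [1,3,4,5,6]), [1,4]), (([1,3,4,5,6], [1,2,3,4,5]), [1,4]),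
      (([2,3,4,5,6], [2,3,4,5,6]), [2,4,5]), (([1,2,3,4,5], [1,2,3,4,5]), [2,3,4]),
      (([2,3,4,5,6], [1,2,3,4,5]), [3,4,5]), (([1,2,3,4,5], [2,3,4,5,6]), [3,4,5]),
      (([2,3,4,5,6], [2,3,4,5]), [4]), (([2,3,4,5], [2,3,4,5,6]), [4]),
      (([1,2,3,4,5], [2,3,4,5]), [4]), (([2,3,4,5], [1,2,3,4,5]), [4])] (A, B) of
   None \<Rightarrow> [] | Some K \<Rightarrow> K)"

lemma longest6_nodes: "longest6 nodes6 = neg6 start6"
  by code_simp


lemma longest6_negative: "list_all (\<lambda>J. list_all (\<lambda>j. at6 (longest6 J) j < 0) J) (subseqs nodes6)"
  by code_simp

definition colongest6 :: "nat list \<Rightarrow> state6" where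
  "colongest6 J = neg6 (longest6 J)"

text \<open>
  The check of the table is cut into functions whose arguments are evaluated once and then shared: each
  subset is paired with the numbers of \<open>w\<^sub>J w\<^sub>I\<close>, and each row of the table uses one word.
\<close>

definition star_ok6 :: "nat list \<Rightarrow> nat list \<Rightarrow> nat list \<times> state6 \<Rightarrow> bool" where
  "star_ok6 A u p \<longleftrightarrow> demazure_word6 u (snd p) = colongest6 (star6 A (fst p))"

definition row_ok6 :: "(nat list \<times> state6) list \<Rightarrow> nat list \<Rightarrow> state6 \<Rightarrow> nat list \<Rightarrow> bool" where
  "row_ok6 ps A x u \<longleftrightarrow> demazure_word6 u start6 = x \<and> list_all (star_ok6 A u) ps"

definition line_ok6 :: "(nat list \<times> state6) list \<Rightarrow> nat list \<times> state6 \<Rightarrow> bool" where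
  "line_ok6 ps p \<longleftrightarrow> row_ok6 ps (fst p) (snd p) (descent_word6 36 (snd p))"

definition table_ok6 :: "(nat list \<times> state6) list \<Rightarrow> bool" where
  "table_ok6 ps \<longleftrightarrow> list_all (line_ok6 ps) ps"

lemma star_table_ok6: "table_ok6 (map (\<lambda>J. (J, colongest6 J)) connected6)"
  by code_simp

lemma filter_in_subseqs: "filter P xs \<in> set (subseqs xs)"
  by (induction xs) (auto simp: Let_def)

lemma set_subseqs_subset: "A \<in> set (subseqs xs) \<Longrightarrow> set A \<subseteq> set xs"
  using subseqs_powset[of xs] by auto

lemma set_nodes6: "set nodes6 = {1, 2, 3, 4, 5, 6}"
  by (simp add: nodes6_def)

lemma descent_word6_lists: "descent_word6 n x \<in> lists {1, 2, 3, 4, 5, 6}"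
proof (induction n arbitrary: x)
  case (Suc n)
  show ?case
  proof (cases "find (\<lambda>i. at6 x i < 0) nodes6")
    case (Some i)
    then have "i \<in> set nodes6"
      by (auto simp: find_Some_iff)
    then show ?thesis
      using Some Suc[of "fire6 i x"] by (simp add: set_nodes6)
  qed simp
qed simp

lemma star6_subseq: "star6 A B \<in> set (subseqs nodes6)"
  by (simp add: star6_def nodes6_def Let_def)

text \<open>
  A path from \<open>i\<close> cannot leave \<open>A\<close> without crossing an edge.
\<close>

lemma cox_connected_no_cut:
  assumes "cox_connected m J" "A \<subseteq> J" "i \<in> A" "j \<in> J"
    and cut: "\<And>a b. a \<in> A \<Longrightarrow> b \<in> J \<Longrightarrow> b \<notin> A \<Longrightarrow> m a b = 2"
  shows "j \<in> A"
proof -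
  have "(i, j) \<in> {(a, b). a \<in> J \<and> b \<in> J \<and> a \<noteq> b \<and> m a b \<noteq> 2}\<^sup>*"
    using assms unfolding cox_connected_def by blast
  then show ?thesis
    by (induction rule: rtrancl_induct) (use assms in auto)
qed

lemma E6_matrix_not_adjacent6:
  "a \<in> {1, 2, 3, 4, 5, 6} \<Longrightarrow> b \<in> {1, 2, 3, 4, 5, 6} \<Longrightarrow> a \<noteq> b \<Longrightarrow> \<not> adjacent6 a b \<Longrightarrow> E6_matrix a b = 2"
  by (auto simp: E6_matrix_def E6_edges_def adjacent6_def doubleton_eq_iff)

lemma connected_in_connected6:
  assumes "J \<subset> {1, 2, 3, 4, 5, 6}" "cox_connected E6_matrix J"
  defines "A \<equiv> filter (\<lambda>i. i \<in> J) nodes6"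
  shows "A \<in> set connected6" "set A = J"
proof -
  show J: "set A = J"
    using assms(1) unfolding A_def by (simp add: set_nodes6 set_filter) blast
  have "\<not> separated6 A"
  proof
    assume "separated6 A"
    then obtain B where B: "B \<in> set (subseqs A)" "B \<noteq> []" "\<not> J \<subseteq> set B"
      and cut: "\<forall>a\<in>set B. \<forall>b\<in>J. b \<in> set B \<or> \<not> adjacent6 a b"
      unfolding separated6_def J by blast
    have BJ: "set B \<subseteq> J"
      using set_subseqs_subset[OF B(1)] J by simp
    obtain i where "i \<in> set B"
      using B(2) by (cases B) auto
    moreover obtain j where "j \<in> J" "j \<notin> set B"
      using B(3) by blast
    moreover have "E6_matrix a b = 2" if "a \<in> set B" "b \<in> J" "b \<notin> set B" for a b
      using that cut BJ assms(1) by (intro E6_matrix_not_adjacent6) auto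
    ultimately show False
      using cox_connected_no_cut[OF assms(2) BJ] by blast
  qed
  moreover have "A \<noteq> nodes6"
    using J assms(1) set_nodes6 by auto
  ultimately show "A \<in> set connected6"
    by (simp add: connected6_def A_def filter_in_subseqs)
qed

section \<open>The operation on subsets in type E6\<close>

locale E6_coxeter = simply_laced_coxeter G I s E6_matrix
  for G :: "('a, 'b) monoid_scheme" (structure) and I and s :: "nat \<Rightarrow> 'a" +
  assumes I: "I = {1, 2, 3, 4, 5, 6}" and fin: "finite (carrier G)"
begin

lemma I_nodes6: "set nodes6 = I"
  by (simp add: I set_nodes6)

definition state :: "(nat \<Rightarrow> int) \<Rightarrow> state6" where
  "state c = (c 1, c 2, c 3, c 4, c 5, c 6)"

lemma state_fire: "i \<in> I \<Longrightarrow> state (fire i c) = fire6 i (state c)"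
  by (auto simp: I state_def fire_def E6_matrix_def E6_edges_def doubleton_eq_iff)

lemma at6_state: "i \<in> I \<Longrightarrow> at6 (state c) i = c i"
  by (auto simp: I state_def)

lemma state_demazure_word:
  "u \<in> lists I \<Longrightarrow> w \<in> carrier G \<Longrightarrow> state (ht (demazure_word u w)) = demazure_word6 u (state (ht w))"
proof (induction u)
  case (Cons i u)
  have "demazure_word u w \<in> carrier G"
    using Cons by (intro demazure_word_closed) auto
  moreover have "at6 (demazure_word6 u (state (ht w))) i = ht (demazure_word u w) i"
    using Cons at6_state[of i "ht (demazure_word u w)"] by simp
  ultimately show ?case
    using Cons by (simp add: demazure_ht demazure6_def state_fire)
qed simp

lemma state_inj:
  assumes "w \<in> carrier G" "x \<in> carrier G" "state (ht w) = state (ht x)"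
  shows "w = x"
  using assms by (intro ht_inj) (auto simp: I state_def)

abbreviation w0 :: "nat list \<Rightarrow> 'a" where "w0 J \<equiv> longest_elt G I s (set J)"

lemma state_longest:
  assumes "J \<in> set (subseqs nodes6)"
  shows "state (ht (w0 J)) = longest6 J"
proof -
  let ?u = "concat (replicate 12 J)"
  have J: "set J \<subseteq> I"
    using set_subseqs_subset[OF assms] I_nodes6 by simp
  have u: "?u \<in> lists (set J)" "?u \<in> lists I"
    using J by auto
  obtain v where v: "v \<in> lists (set J)" "demazure_word ?u \<one> = wprod v"
    using demazure_word_parabolic[OF J u(1)] by auto
  have st: "state (ht (wprod v)) = longest6 J"
    using state_demazure_word[OF u(2), of \<one>] v by (simp add: longest6_def start6_def state_def)
  have "ht (wprod v) j < 0" if j: "j \<in> set J" for j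
    using longest6_negative assms j at6_state[of j "ht (wprod v)"] J st by (force simp: list_all_iff)
  then show ?thesis
    using longest_elt_eqI[OF fin J v(1)] st by simp
qed

lemma w0_closed:
  assumes "J \<in> set (subseqs nodes6)"
  shows "w0 J \<in> carrier G"
  using set_subseqs_subset[OF assms] I_nodes6 by (intro longest_elt_closed[OF fin]) simp

lemma state_colongest:
  assumes "J \<in> set (subseqs nodes6)"
  shows "state (ht (w0 J \<otimes> longest_elt G I s I)) = colongest6 J"
proof -
  have "state (ht (longest_elt G I s I)) = neg6 start6"
    using state_longest[of nodes6] longest6_nodes by (simp add: I_nodes6 subseqs_refl)
  then have "ht (longest_elt G I s I) i = - 1" if "i \<in> I" for i
    using that by (auto simp: I state_def start6_def)
  then have "ht (w0 J \<otimes> longest_elt G I s I) i = - ht (w0 J) i" if "i \<in> I" for i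
    using set_subseqs_subset[OF assms] I_nodes6 that
    by (intro ht_longest_mult[OF fin]) simp_all
  then have "state (ht (w0 J \<otimes> longest_elt G I s I)) = neg6 (state (ht (w0 J)))"
    by (simp add: state_def I)
  then show ?thesis
    using state_longest[OF assms] by (simp add: colongest6_def)
qed

theorem cox_star_connected6:
  assumes "A \<in> set connected6" "B \<in> set connected6"
  shows "cox_star G I s E6_matrix (set A) (set B) = set (star6 A B)"
proof -
  have sub: "A \<in> set (subseqs nodes6)" "B \<in> set (subseqs nodes6)"
    using assms by (simp_all add: connected6_def)
  have subI: "set J \<subseteq> I" if "J \<in> set (subseqs nodes6)" for J
    using set_subseqs_subset[OF that] I_nodes6 by simp
  have top: "longest_elt G I s I \<in> carrier G"
    using w0_closed[of nodes6] by (simp add: I_nodes6 subseqs_refl)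
  define u where "u = descent_word6 36 (colongest6 A)"
  have u: "u \<in> lists I"
    unfolding u_def I by (rule descent_word6_lists)
  have "row_ok6 (map (\<lambda>J. (J, colongest6 J)) connected6) A (colongest6 A) u"
    using star_table_ok6 assms by (auto simp: table_ok6_def line_ok6_def list_all_iff u_def)
  then have run: "demazure_word6 u start6 = colongest6 A" "demazure_word6 u (colongest6 B) = colongest6 (star6 A B)"
    using assms by (auto simp: row_ok6_def star_ok6_def list_all_iff)
  show ?thesis
  proof (rule cox_star_eqI[OF fin subI[OF star6_subseq] subI[OF sub(1)] subI[OF sub(2)] u])
    show "demazure_word u \<one> = w0 A \<otimes> longest_elt G I s I"
      using state_demazure_word[OF u, of \<one>] run(1) state_colongest[OF sub(1)] demazure_word_closed[OF u]
        w0_closed[OF sub(1)] top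
      by (intro state_inj) (simp_all add: start6_def state_def)
    show "demazure_word u (w0 B \<otimes> longest_elt G I s I) = w0 (star6 A B) \<otimes> longest_elt G I s I"
      using state_demazure_word[OF u, of "w0 B \<otimes> longest_elt G I s I"] run(2) demazure_word_closed[OF u]
        state_colongest[OF sub(2)] state_colongest[OF star6_subseq[of A B]]
        w0_closed[OF sub(2)] w0_closed[OF star6_subseq] top
      by (intro state_inj) simp_all
  qed
qed

end

lemma E6_coxeterI:
  assumes "I = {1, 2, 3, 4, 5, 6}" "coxeter_system G I s E6_matrix" "finite (carrier G)"
  shows "E6_coxeter G I s"
  using assms by unfold_locales (auto simp: E6_matrix_def)

theorem mainTheorem5:
  fixes G :: "('a, 'b) monoid_scheme"
    and s :: "nat \<Rightarrow> 'a"
    and I J1 J2 :: "nat set"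
  assumes I: "I = {1, 2, 3, 4, 5, 6}"
    and E6: "coxeter_system G I s E6_matrix"
    and fin: "finite (carrier G)"
    and J1: "J1 \<subset> I" "cox_connected E6_matrix J1"
    and J2: "J2 \<subset> I" "cox_connected E6_matrix J2"
  shows
    "(2 \<notin> J1 \<and> 2 \<notin> J2 \<longrightarrow> cox_star G I s E6_matrix J1 J2 = {})
     \<and>
     (2 \<in> J1 \<and> 2 \<notin> J2 \<longrightarrow>
        cox_star G I s E6_matrix J1 J2 =
          (if J1 = I - {1} \<and> J2 = I - {2} then {4, 6}
           else if J1 = I - {6} \<and> J2 = I - {2} then {1, 4}
           else {}))
     \<and>
     (2 \<in> J1 \<inter> J2 \<longrightarrow>
        cox_star G I s E6_matrix J1 J2 =
          (if J1 = I - {1} \<and> J2 = I - {1} then {2, 4, 5}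
           else if J1 = I - {6} \<and> J2 = I - {6} then {2, 3, 4}
           else if {J1, J2} = {I - {1}, I - {6}} then {3, 4, 5}
           else if {J1, J2} = {I - {1}, I - {1, 6}} then {4}
           else if {J1, J2} = {I - {6}, I - {1, 6}} then {4}
           else {}))"
proof -
  interpret E6_coxeter G I s
    using I E6 fin by (rule E6_coxeterI)
  define A B where "A = filter (\<lambda>i. i \<in> J1) nodes6" and "B = filter (\<lambda>i. i \<in> J2) nodes6"
  have A: "A \<in> set connected6" "set A = J1" and B: "B \<in> set connected6" "set B = J2"
    using connected_in_connected6[OF J1[unfolded I]] connected_in_connected6[OF J2[unfolded I]]
    unfolding A_def B_def by blast+
  have star: "cox_star G I s E6_matrix J1 J2 = set (star6 A B)"
    using cox_star_connected6[OF A(1) B(1)] A(2) B(2) by simp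
  have eq: "J1 = set xs \<longleftrightarrow> A = xs" "J2 = set xs \<longleftrightarrow> B = xs"
    if "filter (\<lambda>i. i \<in> set xs) nodes6 = xs" for xs
    using A(2) B(2) that unfolding A_def B_def by metis+
  have sets: "I - {1} = set [2,3,4,5,6]" "I - {6} = set [1,2,3,4,5]"
      "I - {2} = set [1,3,4,5,6]" "I - {1, 6} = set [2,3,4,5]"
    by (auto simp: I)
  have eqs: "J1 = I - {1} \<longleftrightarrow> A = [2,3,4,5,6]" "J2 = I - {1} \<longleftrightarrow> B = [2,3,4,5,6]"
      "J1 = I - {6} \<longleftrightarrow> A = [1,2,3,4,5]" "J2 = I - {6} \<longleftrightarrow> B = [1,2,3,4,5]"
      "J1 = I - {2} \<longleftrightarrow> A = [1,3,4,5,6]" "J2 = I - {2} \<longleftrightarrow> B = [1,3,4,5,6]"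
      "J1 = I - {1, 6} \<longleftrightarrow> A = [2,3,4,5]" "J2 = I - {1, 6} \<longleftrightarrow> B = [2,3,4,5]"
    unfolding sets by (rule eq; simp add: nodes6_def)+
  have cases: "C = [2,3,4,5,6] \<or> C = [1,2,3,4,5] \<or> C = [1,3,4,5,6] \<or> C = [2,3,4,5] \<or>
      (C \<noteq> [2,3,4,5,6] \<and> C \<noteq> [1,2,3,4,5] \<and> C \<noteq> [1,3,4,5,6] \<and> C \<noteq> [2,3,4,5])" for C :: "nat list"
    by blast
  show ?thesis
    unfolding star doubleton_eq_iff eqs unfolding A(2)[symmetric] B(2)[symmetric]
    using cases[of A] cases[of B] by (elim disjE conjE) (simp_all add: star6_def)
qed

end
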